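(* Let $a_1,a_2:[0,\infty)\to[0,\infty)$ be continuous. Let $f_1,f_2:[0,\infty)\to[0,\infty)$ be continuous and increasing, with $f_1(0)\cdot f_2(0)\ge 0$ and $f_1(s_1)\cdot f_2(s_2)>0$ for all $s_1,s_2>0$. Let $M_1\ge\max\{1,\beta/\overline{\theta}_2(f_2(\alpha))\}$ and $M_2\ge\max\{1,\alpha/\overline{\theta}_1(f_1(\beta))\}$, and suppose there are constants $\overline{c}_1,\overline{c}_2>0$, continuous increasing functions $g_1,g_2:[0,\infty)\to[0,\infty)$ and continuous functions $\overline{\xi}_1,\overline{\xi}_2:[0,\infty)\to[0,\infty)$ such that $$f_1(t_1w_1)\le\overline{c}_1\,g_1(t_1)\,\overline{\xi}_1(w_1)\quad\text{for all } w_1\ge1,\ t_1\ge M_1\overline{\theta}_2(f_2(\alpha)),$$ $$f_2(t_2w_2)\le\overline{c}_2\,g_2(t_2)\,\overline{\xi}_2(w_2)\quad\text{for all } w_2\ge1,\ t_2\ge M_2\overline{\theta}_1(f_1(\beta)).$$ Assume $H_{1,2}(\infty)=H_{2,1}(\infty)=\infty$. Then the system $$\Delta_{\phi_1}u=a_1(|x|)f_1(v),\qquad \Delta_{\phi_2}v=a_2(|x|)f_2(u),\qquad x\in\mathbb{R}^N,$$ has one positive radial solution $(u,v)\in C^1([0,\infty))\times C^1([0,\infty))$ with $(u(0),v(0))=(\alpha,\beta)$. Moreover, if $\overline{P}_{1,2}(\infty)<\infty$ and $\overline{P}_{2,1}(\infty)<\infty$, then $\lim_{r\to\infty}u(r)<\infty$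 and $\lim_{r\to\infty}v(r)<\infty$.
   Context: Standing setting. $N\ge3$ is an integer and $\alpha,\beta\in(0,\infty)$ are arbitrary parameters. $\Delta_{\phi_i}u:=\operatorname{div}(\phi_i(|\nabla u|)\nabla u)$, $i=1,2$, where: - $\phi_i\in C^1((0,\infty),(0,\infty))$ and $\lim_{t\to0}t\phi_i(t)=0$; - $t\phi_i(t)>0$ is strictly increasing for $t>0$; - $h_i^{-1}$ is the inverse function of $h_i(t)=t\phi_i(t)$, $t>0$, and there exist constants $\underline{k}_i,\overline{k}_i>0$, continuous increasing functions $\underline{\theta}_i,\overline{\theta}_i:[0,\infty)\to[0,\infty)$ and continuous functions $\underline{\psi}_i,\overline{\psi}_i:[0,\infty)\to[0,\infty)$ (all fixed) such that $\underline{k}_i\underline{\theta}_i(s_1)\underline{\psi}_i(s_2)\le h_i^{-1}(s_1s_2)\le\overline{k}_i\overline{\theta}_i(s_1)\overline{\psi}_i(s_2)$ for all $s_1,s_2>0$. A radial solution is a pair of functions of $r=|x|$; radial solutions correspond to solutions on $[0,\infty)$ of $(r^{N-1}\phi_1(|u'|)u')'=r^{N-1}a_1(r)f_1(v)$, $(r^{N-1}\phi_2(|v'|)v')'=r^{N-1}a_2(r)f_2(u)$ with $u'(0)=v'(0)=0$. Notation, in terms of the data in the claim: $$\overline{\mathcal{A}}_{a_i}(t)=\int_0^t\overline{k}_i\overline{\psi}_i\Big(s^{1-N}\int_0^sz^{N-1}a_i(z)dz\Big)ds,$$ $$\overline{P}_{1,2}(r)=\int_0^r\overline{\psi}_1\Big(\overline{c}_1y^{1-N}\int_0^yt^{N-1}a_1(t)\overline{\xi}_1(1+\overline{\mathcal{A}}_{a_2}(t))dt\Big)dy,$$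 $$\overline{P}_{2,1}(r)=\int_0^r\overline{\psi}_2\Big(\overline{c}_2y^{1-N}\int_0^yt^{N-1}a_2(t)\overline{\xi}_2(1+\overline{\mathcal{A}}_{a_1}(t))dt\Big)dy,$$ $$H_{1,2}(r)=\int_\alpha^r\frac{dt}{\overline{\theta}_1(g_1(M_1\overline{\theta}_2(f_2(t))))},\qquad H_{2,1}(r)=\int_\beta^r\frac{dt}{\overline{\theta}_2(g_2(M_2\overline{\theta}_1(f_1(t))))},$$ and for each function $F$ among $\overline{P}_{1,2},\overline{P}_{2,1},H_{1,2},H_{2,1}$, $F(\infty):=\lim_{r\to\infty}F(r)$. *)

theory Defs
  imports "HOL-Analysis.Analysis"
begin

definition C1_on :: "real set \<Rightarrow> (real \<Rightarrow> real) \<Rightarrow> bool" where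
  "C1_on S f \<longleftrightarrow>
     (\<exists>f'. continuous_on S f' \<and> (\<forall>r\<in>S. (f has_real_derivative f' r) (at r within S)))"

definition cont_nonneg :: "(real \<Rightarrow> real) \<Rightarrow> bool" where
  "cont_nonneg f \<longleftrightarrow> continuous_on {0..} f \<and> f ` {0..} \<subseteq> {0..}"

text \<open>``Increasing'' is non-strict, as opposed to ``strictly increasing''.\<close>

definition cont_incr_nonneg :: "(real \<Rightarrow> real) \<Rightarrow> bool" where
  "cont_incr_nonneg f \<longleftrightarrow> cont_nonneg f \<and> mono_on {0..} f"

definition h_of :: "(real \<Rightarrow> real) \<Rightarrow> real \<Rightarrow> real" where
  "h_of \<phi> t = t * \<phi> t"

definition h_inv :: "(real \<Rightarrow> real) \<Rightarrow> real \<Rightarrow> real" where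
  "h_inv \<phi> = the_inv_into {0<..} (h_of \<phi>)"

text \<open>Standing hypotheses on one function \<open>\<phi>\<close>; the suffixes \<open>l\<close> and \<open>u\<close> stand for the
  under- and overlined data. That \<open>h\<close> maps onto \<open>(0,\<infinity>)\<close> is what makes its inverse
  meaningful at every product \<open>s1 * s2\<close> in the two-sided bound.\<close>

definition phi_structure ::
  "(real \<Rightarrow> real) \<Rightarrow> real \<Rightarrow> real \<Rightarrow> (real \<Rightarrow> real) \<Rightarrow> (real \<Rightarrow> real)
    \<Rightarrow> (real \<Rightarrow> real) \<Rightarrow> (real \<Rightarrow> real) \<Rightarrow> bool" where
  "phi_structure \<phi> kl ku \<theta>l \<theta>u \<psi>l \<psi>u \<longleftrightarrow>
     \<phi> C1_differentiable_on {0<..} \<and> (\<forall>t>0. \<phi> t > 0) \<and>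
     (h_of \<phi> \<longlongrightarrow> 0) (at_right 0) \<and>
     strict_mono_on {0<..} (h_of \<phi>) \<and>
     h_of \<phi> ` {0<..} = {0<..} \<and>
     kl > 0 \<and> ku > 0 \<and>
     cont_incr_nonneg \<theta>l \<and> cont_incr_nonneg \<theta>u \<and>
     cont_nonneg \<psi>l \<and> cont_nonneg \<psi>u \<and>
     (\<forall>s1>0. \<forall>s2>0.
        kl * \<theta>l s1 * \<psi>l s2 \<le> h_inv \<phi> (s1 * s2) \<and>
        h_inv \<phi> (s1 * s2) \<le> ku * \<theta>u s1 * \<psi>u s2)"

text \<open>Divergence as the trace of the derivative.\<close>

definition has_divergence :: "('a::euclidean_space \<Rightarrow> 'a) \<Rightarrow> real \<Rightarrow> 'a \<Rightarrow> bool" where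
  "has_divergence F d x \<longleftrightarrow>
     (\<exists>F'. (F has_derivative F') (at x) \<and> d = (\<Sum>b\<in>Basis. F' b \<bullet> b))"

text \<open>\<open>div (\<phi>(|\<nabla>U|) \<nabla>U) = d\<close> at \<open>x\<close>, in the classical sense. Where the gradient vanishes
  the field is \<open>0\<close> whatever the (meaningless) value \<open>\<phi> 0\<close> is, in agreement with
  \<open>t \<phi>(t) \<rightarrow> 0\<close>.\<close>

definition has_phi_laplacian ::
  "(real \<Rightarrow> real) \<Rightarrow> ('a::euclidean_space \<Rightarrow> real) \<Rightarrow> real \<Rightarrow> 'a \<Rightarrow> bool" where
  "has_phi_laplacian \<phi> U d x \<longleftrightarrow>
     (\<exists>G. (\<forall>y. GDERIV U y :> G y) \<and>
          has_divergence (\<lambda>y. \<phi> (norm (G y)) *\<^sub>R G y) d x)"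

definition positive_entire_solution ::
  "(real \<Rightarrow> real) \<Rightarrow> (real \<Rightarrow> real) \<Rightarrow> (real \<Rightarrow> real) \<Rightarrow> (real \<Rightarrow> real)
    \<Rightarrow> (real \<Rightarrow> real) \<Rightarrow> (real \<Rightarrow> real)
    \<Rightarrow> ('a::euclidean_space \<Rightarrow> real) \<Rightarrow> ('a \<Rightarrow> real) \<Rightarrow> bool" where
  "positive_entire_solution \<phi>1 \<phi>2 a1 a2 f1 f2 U V \<longleftrightarrow>
     (\<forall>x. U x > 0 \<and> V x > 0 \<and>
          has_phi_laplacian \<phi>1 U (a1 (norm x) * f1 (V x)) x \<and>
          has_phi_laplacian \<phi>2 V (a2 (norm x) * f2 (U x)) x)"

text \<open>In the next two definitions the value of \<open>powr\<close> at base \<open>0\<close> (namely \<open>0\<close>) affects the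
  outer integrand only at one point.\<close>

definition A_bar :: "nat \<Rightarrow> real \<Rightarrow> (real \<Rightarrow> real) \<Rightarrow> (real \<Rightarrow> real) \<Rightarrow> real \<Rightarrow> real" where
  "A_bar N k \<psi> a t =
     integral {0..t} (\<lambda>s. k * \<psi> (s powr (1 - real N) * integral {0..s} (\<lambda>z. z ^ (N - 1) * a z)))"

text \<open>\<open>A\<close> is the function \<open>A_bar\<close> belonging to the other equation.\<close>

definition P_bar ::
  "nat \<Rightarrow> real \<Rightarrow> (real \<Rightarrow> real) \<Rightarrow> (real \<Rightarrow> real) \<Rightarrow> (real \<Rightarrow> real) \<Rightarrow> (real \<Rightarrow> real)
    \<Rightarrow> real \<Rightarrow> real" where
  "P_bar N c \<psi> \<xi> a A r =
     integral {0..r} (\<lambda>y. \<psi> (c * y powr (1 - real N) *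
        integral {0..y} (\<lambda>t. t ^ (N - 1) * a t * \<xi> (1 + A t))))"

text \<open>\<open>H_fun \<alpha> \<theta>1 g1 M1 \<theta>2 f2\<close> is \<open>H_{1,2}\<close> and \<open>H_fun \<beta> \<theta>2 g2 M2 \<theta>1 f1\<close> is \<open>H_{2,1}\<close>,
  on \<open>r \<ge> \<alpha>\<close> resp. \<open>r \<ge> \<beta>\<close>; only the behaviour as \<open>r \<rightarrow> \<infinity>\<close> matters.\<close>

definition H_fun ::
  "real \<Rightarrow> (real \<Rightarrow> real) \<Rightarrow> (real \<Rightarrow> real) \<Rightarrow> real \<Rightarrow> (real \<Rightarrow> real) \<Rightarrow> (real \<Rightarrow> real)
    \<Rightarrow> real \<Rightarrow> real" where
  "H_fun \<gamma> \<theta> g M \<theta>' f r = integral {\<gamma>..r} (\<lambda>t. 1 / \<theta> (g (M * \<theta>' (f t))))"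

end

theory Submission
  imports Defs
begin

text \<open>
  For radial functions the divergence operator integrates explicitly: \<open>u\<close> solves
  \<open>div (\<phi>(|\<nabla>u|) \<nabla>u) = p\<close> with \<open>u(0) = \<gamma>\<close> as soon as
  \<open>u(r) = \<gamma> + \<integral>\<^sub>0\<^sup>r h\<^sup>-\<^sup>1(s\<^bsup>1-N\<^esup> \<integral>\<^sub>0\<^sup>s z\<^bsup>N-1\<^esup> p(z) dz) ds\<close>, because then the field
  \<open>\<phi>(|\<nabla>u|) \<nabla>u\<close> is \<open>q(|x|) x\<close> with \<open>q(r)\<close> the flux divided by \<open>r\<close>. Its divergence
  \<open>N q + r q'\<close> is \<open>p\<close> away from the origin by the product rule, and at the origin because
  \<open>q(r)\<close> tends to \<open>p(0)/N\<close> by l'Hospital's rule (\<open>radial_op_phi_laplacian\<close>).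

  Write \<open>T1\<close> and \<open>T2\<close> for the resulting maps \<open>v \<mapsto> u\<close> and \<open>u \<mapsto> v\<close> of the two equations. Both are
  monotone, so iterating \<open>T1 \<circ> T2\<close> from the constant \<open>\<alpha>\<close> gives an increasing sequence, and a
  fixed point appears in the limit by dominated convergence once the sequence is locally
  bounded. The Keller-Osserman type divergence of \<open>H\<close> provides that bound. If
  \<open>w \<le> u := T1 (T2 w)\<close>, monotonicity of \<open>u\<close> and \<open>f\<^sub>2\<close> pulls \<open>f\<^sub>2(u(r))\<close> out of the integral
  that defines \<open>T2 w\<close>, so that \<open>T2 w \<le> M \<theta>\<^sub>2(f\<^sub>2(u)) (1 + A)\<close> (\<open>inner_bound\<close>). The growth
  condition on \<open>f\<^sub>1\<close> separates the two factors, and a second application of the same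
  argument yields \<open>u' \<le> k \<theta>\<^sub>1(g(M \<theta>\<^sub>2(f\<^sub>2(u)))) P'\<close> (\<open>outer_slope_bound\<close>). Dividing and
  integrating gives \<open>H(u(r)) \<le> k P(r)\<close> (\<open>H_bound\<close>), which bounds \<open>u(r)\<close> because \<open>H\<close> tends
  to infinity.

  The same inequality, now for the fixed point, shows that \<open>u\<close> is bounded when \<open>P\<close> is, and an
  increasing bounded function has a limit. For \<open>v\<close>, which is a fixed point of \<open>T2 \<circ> T1\<close>,
  the argument is applied with the roles of the two equations exchanged; this is why it is
  carried out in a locale that mentions the growth condition of only one of them.
\<close>

section \<open>The inverse of \<open>h\<close>, continued to the real line\<close>

text \<open>The flux of a source that vanishes near the origin is \<open>0\<close>, where \<open>h_inv\<close> is unspecified. The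
  value there is forced by \<open>h(t) \<rightarrow> 0\<close>; the identity on the negative axis makes the extension a
  monotone surjection of the whole line.\<close>

definition h_inv0 :: "(real \<Rightarrow> real) \<Rightarrow> real \<Rightarrow> real" where
  "h_inv0 \<phi> t = (if t > 0 then h_inv \<phi> t else t)"

lemma h_inv_pos:
  assumes "phi_structure \<phi> kl ku \<theta>l \<theta>u \<psi>l \<psi>u" "t > 0"
  shows "h_inv \<phi> t > 0" and "h_of \<phi> (h_inv \<phi> t) = t"
proof -
  have inj: "inj_on (h_of \<phi>) {0<..}"
    using assms strict_mono_on_imp_inj_on unfolding phi_structure_def by blast
  have t: "t \<in> h_of \<phi> ` {0<..}"
    using assms unfolding phi_structure_def by simp
  show "h_inv \<phi> t > 0"
    using the_inv_into_into[OF inj t order_refl] unfolding h_inv_def by simp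
  show "h_of \<phi> (h_inv \<phi> t) = t"
    using f_the_inv_into_f[OF inj t] unfolding h_inv_def by simp
qed

lemma h_inv_h_of:
  assumes "phi_structure \<phi> kl ku \<theta>l \<theta>u \<psi>l \<psi>u" "t > 0"
  shows "h_inv \<phi> (h_of \<phi> t) = t"
proof -
  have "inj_on (h_of \<phi>) {0<..}"
    using assms strict_mono_on_imp_inj_on unfolding phi_structure_def by blast
  then show ?thesis unfolding h_inv_def using assms(2) by (simp add: the_inv_into_f_f)
qed

lemma h_inv0_mono:
  assumes "phi_structure \<phi> kl ku \<theta>l \<theta>u \<psi>l \<psi>u" "s \<le> t"
  shows "h_inv0 \<phi> s \<le> h_inv0 \<phi> t"
proof (cases "s > 0")
  case True
  then have "t > 0" using assms by simp
  note p = h_inv_pos[OF assms(1) \<open>s > 0\<close>] h_inv_pos[OF assms(1) \<open>t > 0\<close>]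
  have sm: "strict_mono_on {0<..} (h_of \<phi>)"
    using assms unfolding phi_structure_def by blast
  have "h_inv \<phi> s \<le> h_inv \<phi> t"
  proof (rule ccontr)
    assume "\<not> ?thesis"
    then have "h_of \<phi> (h_inv \<phi> t) < h_of \<phi> (h_inv \<phi> s)"
      using strict_mono_onD[OF sm, of "h_inv \<phi> t" "h_inv \<phi> s"] p by simp
    then show False using p assms by simp
  qed
  then show ?thesis using True \<open>t > 0\<close> by (simp add: h_inv0_def)
next
  case False
  then show ?thesis
    using h_inv_pos(1)[OF assms(1), of t] assms(2) by (auto simp: h_inv0_def)
qed

text \<open>A monotone function with a full range has no jumps.\<close>

lemma h_inv0_continuous:
  assumes "phi_structure \<phi> kl ku \<theta>l \<theta>u \<psi>l \<psi>u"
  shows "continuous_on S (h_inv0 \<phi>)"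
proof -
  have "y \<in> range (h_inv0 \<phi>)" for y
  proof (cases "y > 0")
    case True
    have "h_of \<phi> y > 0" using assms True unfolding phi_structure_def h_of_def by simp
    then have "h_inv0 \<phi> (h_of \<phi> y) = y"
      using h_inv_h_of[OF assms True] by (simp add: h_inv0_def)
    then show ?thesis by (metis rangeI)
  next
    case False
    then have "h_inv0 \<phi> y = y" by (simp add: h_inv0_def)
    then show ?thesis by (metis rangeI)
  qed
  then have "range (h_inv0 \<phi>) = UNIV" by blast
  then have "continuous_on UNIV (h_inv0 \<phi>)"
    by (intro continuous_onI_mono) (auto intro: h_inv0_mono[OF assms])
  then show ?thesis using continuous_on_subset by blast
qed

lemma h_inv0_0: "h_inv0 \<phi> 0 = 0"
  by (simp add: h_inv0_def)

lemma h_inv0_nonneg: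
  assumes "phi_structure \<phi> kl ku \<theta>l \<theta>u \<psi>l \<psi>u" "t \<ge> 0"
  shows "h_inv0 \<phi> t \<ge> 0"
  using h_inv0_mono[OF assms] by (simp add: h_inv0_0)

lemma phi_h_inv0:
  assumes "phi_structure \<phi> kl ku \<theta>l \<theta>u \<psi>l \<psi>u" "t \<ge> 0"
  shows "\<phi> (h_inv0 \<phi> t) * h_inv0 \<phi> t = t"
proof (cases "t = 0")
  case False
  then have "t > 0" using assms(2) by simp
  then show ?thesis
    using h_inv_pos(2)[OF assms(1), of t] by (simp add: h_inv0_def h_of_def mult.commute)
qed (simp add: h_inv0_0)

lemma cont_nonneg_nonneg: "cont_nonneg f \<Longrightarrow> x \<ge> 0 \<Longrightarrow> f x \<ge> 0"
  unfolding cont_nonneg_def by (drule conjunct2, drule subsetD[of _ _ "f x"]) simp_all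

lemma cont_nonneg_compose:
  assumes "cont_nonneg f" "continuous_on S g" "\<And>x. x \<in> S \<Longrightarrow> g x \<ge> 0"
  shows "continuous_on S (\<lambda>x. f (g x))"
  by (rule continuous_on_compose2[of "{0..}" f S g]) (use assms in \<open>auto simp: cont_nonneg_def\<close>)

lemma cont_incr_nonneg_mono:
  "cont_incr_nonneg f \<Longrightarrow> 0 \<le> x \<Longrightarrow> x \<le> y \<Longrightarrow> f x \<le> f y"
  unfolding cont_incr_nonneg_def mono_on_def by auto

lemma h_inv0_mult_le:
  assumes "phi_structure \<phi> kl ku \<theta>l \<theta>u \<psi>l \<psi>u" "s > 0" "t \<ge> 0"
  shows "h_inv0 \<phi> (s * t) \<le> ku * \<theta>u s * \<psi>u t"
proof (cases "t = 0")
  case True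
  have "0 \<le> ku * \<theta>u s * \<psi>u t"
    using assms cont_nonneg_nonneg[of \<theta>u s] cont_nonneg_nonneg[of \<psi>u t]
    unfolding phi_structure_def cont_incr_nonneg_def by simp
  then show ?thesis using True by (simp add: h_inv0_0)
next
  case False
  then have "t > 0" using assms by simp
  then show ?thesis using assms unfolding phi_structure_def h_inv0_def by simp
qed

text \<open>The upper bound for \<open>h_inv\<close> is a product that dominates a positive number, so neither factor
  can vanish. This keeps the integrand of \<open>H_fun\<close> finite.\<close>

lemma theta_upper_pos:
  assumes "phi_structure \<phi> kl ku \<theta>l \<theta>u \<psi>l \<psi>u" "s > 0"
  shows "\<theta>u s > 0"
proof -
  have "0 < h_inv0 \<phi> (s * 1)"
    using h_inv_pos[OF assms(1), of s] assms(2) by (simp add: h_inv0_def)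
  also have "\<dots> \<le> ku * \<theta>u s * \<psi>u 1"
    using h_inv0_mult_le[OF assms, of 1] by simp
  finally have "\<theta>u s \<noteq> 0" by auto
  moreover have "\<theta>u s \<ge> 0"
    using assms cont_nonneg_nonneg[of \<theta>u s]
    unfolding phi_structure_def cont_incr_nonneg_def by simp
  ultimately show ?thesis by simp
qed

section \<open>The radial flux\<close>

text \<open>For a radial solution with source \<open>p\<close> this is \<open>h(u'(r))\<close>: the equation
  \<open>(r\<^bsup>N-1\<^esup> h(u'))' = r\<^bsup>N-1\<^esup> p\<close> integrated once.\<close>

definition radial_flux :: "nat \<Rightarrow> (real \<Rightarrow> real) \<Rightarrow> real \<Rightarrow> real" where
  "radial_flux N p r = r powr (1 - real N) * integral {0..r} (\<lambda>s. s ^ (N - 1) * p s)"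

lemma radial_flux_0: "radial_flux N p 0 = 0"
  by (simp add: radial_flux_def)

lemma weighted_continuous:
  fixes p :: "real \<Rightarrow> real"
  assumes "continuous_on {0..} p"
  shows "continuous_on {0..r} (\<lambda>s. s ^ n * p s)"
proof -
  have "continuous_on {0..r} p"
    by (rule continuous_on_subset[OF assms]) simp
  then show ?thesis
    by (rule continuous_on_mult[OF continuous_on_power[OF continuous_on_id]])
qed

lemma weighted_integrable:
  fixes p :: "real \<Rightarrow> real"
  assumes "continuous_on {0..} p"
  shows "(\<lambda>s. s ^ n * p s) integrable_on {0..r}"
  by (rule integrable_continuous_real[OF weighted_continuous[OF assms]])

lemma radial_flux_cmult: "radial_flux N (\<lambda>s. c * p s) r = c * radial_flux N p r"
  unfolding radial_flux_def by (simp add: mult.left_commute)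

lemma radial_flux_mono:
  assumes "continuous_on {0..} p" "continuous_on {0..} q"
    and "\<And>s. 0 \<le> s \<Longrightarrow> s \<le> r \<Longrightarrow> p s \<le> q s"
  shows "radial_flux N p r \<le> radial_flux N q r"
  unfolding radial_flux_def
  by (rule mult_left_mono[OF integral_le[OF weighted_integrable weighted_integrable]])
    (use assms in \<open>auto intro: mult_left_mono\<close>)

lemma radial_flux_nonneg:
  assumes "\<And>s. 0 \<le> s \<Longrightarrow> p s \<ge> 0"
  shows "radial_flux N p r \<ge> 0"
proof -
  let ?w = "\<lambda>s. s ^ (N - 1) * p s"
  have "integral {0..r} ?w \<ge> 0"
  proof (cases "?w integrable_on {0..r}")
    case True
    then show ?thesis by (rule integral_nonneg) (simp add: assms)
  qed (simp add: not_integrable_integral)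
  then show ?thesis unfolding radial_flux_def by simp
qed

lemma weighted_integral_deriv:
  fixes p :: "real \<Rightarrow> real"
  assumes "continuous_on {0..} p" "r > 0"
  shows "((\<lambda>r. integral {0..r} (\<lambda>s. s ^ n * p s)) has_real_derivative r ^ n * p r) (at r)"
proof -
  have "((\<lambda>r. integral {0..r} (\<lambda>s. s ^ n * p s)) has_real_derivative r ^ n * p r)
      (at r within {0..r+1})"
    using assms by (intro integral_has_real_derivative weighted_continuous) auto
  then show ?thesis using assms by (simp add: at_within_Icc_at)
qed

lemma radial_flux_div:
  assumes "r > 0"
  shows "radial_flux N p r / r = integral {0..r} (\<lambda>s. s ^ (N - 1) * p s) / r ^ N"
proof -
  have "r powr (1 - real N) = r / r ^ N"
    using assms by (simp add: powr_diff powr_realpow)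
  then show ?thesis using assms unfolding radial_flux_def by simp
qed

text \<open>This is the equation \<open>N q + r q' = p\<close> for \<open>q(r)\<close> equal to the flux divided by \<open>r\<close>, solved for
  \<open>q'\<close>. The quotient rather than the flux itself is the coefficient of \<open>x\<close> in the vector field whose
  divergence is taken later.\<close>

lemma radial_flux_div_deriv:
  assumes "continuous_on {0..} p" "r > 0" "N \<ge> 1"
  shows "((\<lambda>r. radial_flux N p r / r) has_real_derivative
           (p r - real N * (radial_flux N p r / r)) / r) (at r)"
proof -
  let ?I = "\<lambda>r. integral {0..r} (\<lambda>s. s ^ (N - 1) * p s)"
  obtain n where n: "N = Suc n" using assms(3) by (cases N) auto
  have "((\<lambda>r. ?I r / r ^ N) has_real_derivative
      (r ^ (N - 1) * p r * r ^ N - ?I r * (real N * r ^ (N - 1))) / (r ^ N * r ^ N)) (at r)"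
    using assms by (auto intro!: derivative_eq_intros weighted_integral_deriv)
  also have "(r ^ (N - 1) * p r * r ^ N - ?I r * (real N * r ^ (N - 1))) / (r ^ N * r ^ N)
      = (p r - real N * (radial_flux N p r / r)) / r"
    unfolding radial_flux_div[OF assms(2)] using assms(2) by (simp add: n field_simps)
  finally show ?thesis
    by (rule has_field_derivative_transform_within_open[where S = "{0<..}"])
      (use assms in \<open>auto simp: radial_flux_div\<close>)
qed

text \<open>L'Hospital's rule: the quotient of the derivatives of \<open>\<integral>\<^sub>0\<^sup>r s\<^bsup>N-1\<^esup> p(s) ds\<close> and \<open>r\<^sup>N\<close> is \<open>p(r)/N\<close>.\<close>

lemma radial_flux_div_limit:
  assumes "continuous_on {0..} p" "N \<ge> 1"
  shows "((\<lambda>r. radial_flux N p r / r) \<longlongrightarrow> p 0 / real N) (at_right 0)"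
proof -
  let ?I = "\<lambda>r. integral {0..r} (\<lambda>s. s ^ (N - 1) * p s)"
  have pos: "eventually (\<lambda>r. r > 0) (at_right (0::real))"
    by (simp add: eventually_at_right_less)
  have p0: "(p \<longlongrightarrow> p 0) (at_right 0)"
    using assms(1) unfolding continuous_on_def
    by (metis atLeast_iff at_within_Ici_at_right order_refl)
  have "continuous_on {0..1} ?I"
    using assms(1) by (intro indefinite_integral_continuous_1 weighted_integrable)
  then have "(?I \<longlongrightarrow> ?I 0) (at_right 0)"
    by (intro continuous_on_Icc_at_rightD[where b = 1]) auto
  then have I0: "(?I \<longlongrightarrow> 0) (at_right 0)" by simp
  have "((\<lambda>r. ?I r / r ^ N) \<longlongrightarrow> p 0 / real N) (at_right 0)"
  proof (rule lhopital_right_0[where f' = "\<lambda>r. r ^ (N - 1) * p r"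
        and g' = "\<lambda>r. real N * r ^ (N - 1)"])
    show "((\<lambda>r. r ^ N) \<longlongrightarrow> 0) (at_right (0::real))"
      using assms(2) by (auto intro!: tendsto_eq_intros)
    have "eventually (\<lambda>r. p r / real N = r ^ (N - 1) * p r / (real N * r ^ (N - 1))) (at_right 0)"
      using pos by eventually_elim simp
    moreover have "((\<lambda>r. p r / real N) \<longlongrightarrow> p 0 / real N) (at_right 0)"
      using assms(2) by (intro tendsto_intros p0) auto
    ultimately show "((\<lambda>r. r ^ (N - 1) * p r / (real N * r ^ (N - 1))) \<longlongrightarrow> p 0 / real N) (at_right 0)"
      using Lim_transform_eventually by fastforce
    show "eventually (\<lambda>r. (?I has_real_derivative r ^ (N - 1) * p r) (at r)) (at_right 0)"
      using pos by eventually_elim (use assms in \<open>auto intro: weighted_integral_deriv\<close>)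
    show "eventually (\<lambda>r. ((\<lambda>r. r ^ N) has_real_derivative real N * r ^ (N - 1)) (at r)) (at_right 0)"
      by (auto intro!: derivative_eq_intros always_eventually)
    show "eventually (\<lambda>r::real. r ^ N \<noteq> 0) (at_right 0)"
      using pos by eventually_elim auto
    show "eventually (\<lambda>r::real. real N * r ^ (N - 1) \<noteq> 0) (at_right 0)"
      using pos by eventually_elim (use assms in auto)
  qed (fact I0)
  moreover have "eventually (\<lambda>r. ?I r / r ^ N = radial_flux N p r / r) (at_right 0)"
    using pos by eventually_elim (simp add: radial_flux_div)
  ultimately show ?thesis using Lim_transform_eventually by fastforce
qed

lemma radial_flux_continuous:
  assumes "continuous_on {0..} p" "N \<ge> 1"
  shows "continuous_on {0..} (radial_flux N p)"
  unfolding continuous_on_def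
proof
  fix r :: real assume r: "r \<in> {0..}"
  show "(radial_flux N p \<longlongrightarrow> radial_flux N p r) (at r within {0..})"
  proof (cases "r = 0")
    case True
    have "((\<lambda>r. r * (radial_flux N p r / r)) \<longlongrightarrow> 0 * (p 0 / real N)) (at_right 0)"
      by (rule tendsto_mult[OF tendsto_ident_at radial_flux_div_limit[OF assms]])
    moreover have "eventually (\<lambda>r. r * (radial_flux N p r / r) = radial_flux N p r) (at_right 0)"
      using eventually_at_right_less[of "0::real"] by eventually_elim simp
    ultimately have "(radial_flux N p \<longlongrightarrow> 0) (at_right 0)"
      using Lim_transform_eventually by fastforce
    then show ?thesis using True by (simp add: at_within_Ici_at_right radial_flux_0)
  next
    case False
    then have r: "r > 0" using r by simp
    have "((\<lambda>r. r * (radial_flux N p r / r)) \<longlongrightarrow> r * (radial_flux N p r / r)) (at r)"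
      using DERIV_isCont[OF radial_flux_div_deriv[OF assms(1) r assms(2)]]
      unfolding isCont_def by (rule tendsto_mult[OF tendsto_ident_at])
    moreover have "(\<lambda>r. r * (radial_flux N p r / r)) = radial_flux N p"
      by (auto simp: radial_flux_0)
    ultimately have "(radial_flux N p \<longlongrightarrow> radial_flux N p r) (at r)" using r by simp
    then show ?thesis using tendsto_within_subset by blast
  qed
qed

section \<open>The integral operator of one equation\<close>

definition radial_op :: "nat \<Rightarrow> (real \<Rightarrow> real) \<Rightarrow> real \<Rightarrow> (real \<Rightarrow> real) \<Rightarrow> real \<Rightarrow> real" where
  "radial_op N \<phi> \<gamma> p r = \<gamma> + integral {0..r} (\<lambda>s. h_inv0 \<phi> (radial_flux N p s))"

lemma radial_op_0: "radial_op N \<phi> \<gamma> p 0 = \<gamma>"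
  by (simp add: radial_op_def)

lemma slope_continuous:
  assumes "phi_structure \<phi> kl ku \<theta>l \<theta>u \<psi>l \<psi>u" "N \<ge> 1" "continuous_on {0..} p"
  shows "continuous_on {0..} (\<lambda>s. h_inv0 \<phi> (radial_flux N p s))"
  by (rule continuous_on_compose2[OF h_inv0_continuous[OF assms(1), of UNIV]
      radial_flux_continuous[OF assms(3,2)]]) simp

lemma slope_integrable:
  assumes "phi_structure \<phi> kl ku \<theta>l \<theta>u \<psi>l \<psi>u" "N \<ge> 1" "continuous_on {0..} p"
  shows "(\<lambda>s. h_inv0 \<phi> (radial_flux N p s)) integrable_on {0..r}"
  by (rule integrable_continuous_real[OF continuous_on_subset[OF slope_continuous[OF assms]]]) simp

lemma radial_op_deriv:
  assumes "phi_structure \<phi> kl ku \<theta>l \<theta>u \<psi>l \<psi>u" "N \<ge> 1" "continuous_on {0..} p" "r \<ge> 0"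
  shows "(radial_op N \<phi> \<gamma> p has_real_derivative h_inv0 \<phi> (radial_flux N p r)) (at r within {0..})"
proof -
  have "((\<lambda>r. \<gamma> + integral {0..r} (\<lambda>s. h_inv0 \<phi> (radial_flux N p s))) has_real_derivative
      0 + h_inv0 \<phi> (radial_flux N p r)) (at r within {0..r+1})"
    using assms by (intro DERIV_add DERIV_const integral_has_real_derivative
        continuous_on_subset[OF slope_continuous[OF assms(1-3)]]) auto
  moreover have "at r within {0..r+1} = at r within {0..}"
    by (rule at_within_nhd[where S = "{..<r+1}"]) auto
  ultimately show ?thesis unfolding radial_op_def[abs_def] by simp
qed

lemma radial_op_continuous:
  assumes "phi_structure \<phi> kl ku \<theta>l \<theta>u \<psi>l \<psi>u" "N \<ge> 1" "continuous_on {0..} p"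
  shows "continuous_on {0..} (radial_op N \<phi> \<gamma> p)"
  by (rule DERIV_continuous_on) (rule radial_op_deriv[OF assms], simp)

lemma radial_op_C1:
  assumes "phi_structure \<phi> kl ku \<theta>l \<theta>u \<psi>l \<psi>u" "N \<ge> 1" "continuous_on {0..} p"
  shows "C1_on {0..} (radial_op N \<phi> \<gamma> p)"
  unfolding C1_on_def
  by (rule exI[of _ "\<lambda>s. h_inv0 \<phi> (radial_flux N p s)"])
    (simp add: slope_continuous[OF assms] radial_op_deriv[OF assms])

lemma radial_op_mono:
  assumes "phi_structure \<phi> kl ku \<theta>l \<theta>u \<psi>l \<psi>u" "N \<ge> 1"
    and "continuous_on {0..} p" "continuous_on {0..} q"
    and "\<And>s. 0 \<le> s \<Longrightarrow> p s \<le> q s"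
  shows "radial_op N \<phi> \<gamma> p r \<le> radial_op N \<phi> \<gamma> q r"
  unfolding radial_op_def
proof (intro add_left_mono integral_le)
  show "h_inv0 \<phi> (radial_flux N p s) \<le> h_inv0 \<phi> (radial_flux N q s)" for s
    by (intro h_inv0_mono[OF assms(1)] radial_flux_mono assms)
qed (rule slope_integrable[OF assms(1,2)], fact)+

lemma radial_op_mono_on:
  assumes "phi_structure \<phi> kl ku \<theta>l \<theta>u \<psi>l \<psi>u" "N \<ge> 1"
    and "continuous_on {0..} p" "\<And>s. 0 \<le> s \<Longrightarrow> p s \<ge> 0"
  shows "mono_on {0..} (radial_op N \<phi> \<gamma> p)"
proof (rule mono_onI)
  fix r s :: real assume "r \<in> {0..}" "r \<le> s"
  then show "radial_op N \<phi> \<gamma> p r \<le> radial_op N \<phi> \<gamma> p s"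
    unfolding radial_op_def
    by (intro add_left_mono integral_subset_le slope_integrable[OF assms(1-3)])
      (simp_all add: h_inv0_nonneg[OF assms(1)] radial_flux_nonneg assms(4))
qed

lemma radial_op_ge:
  assumes "phi_structure \<phi> kl ku \<theta>l \<theta>u \<psi>l \<psi>u" "N \<ge> 1"
    and "continuous_on {0..} p" "\<And>s. 0 \<le> s \<Longrightarrow> p s \<ge> 0" "r \<ge> 0"
  shows "radial_op N \<phi> \<gamma> p r \<ge> \<gamma>"
  using mono_onD[OF radial_op_mono_on[OF assms(1-4), of \<gamma>], of 0 r] assms(5)
  by (simp add: radial_op_0)

text \<open>Dominated convergence, once for the flux and once for its image under \<open>h_inv0\<close>. Only the
  pointwise limit \<open>p'\<close> is given, without continuity; the continuity of the image function is
  part of the conclusion, since it is an indefinite integral. In the iteration this is where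
  the limit function acquires its regularity.\<close>

lemma radial_op_limit:
  assumes "phi_structure \<phi> kl ku \<theta>l \<theta>u \<psi>l \<psi>u" "N \<ge> 1"
    and cont: "\<And>m. continuous_on {0..} (p m)"
    and nonneg: "\<And>m s. 0 \<le> s \<Longrightarrow> p m s \<ge> 0"
    and dom: "\<And>r. 0 \<le> r \<Longrightarrow>
      \<exists>q. continuous_on {0..} q \<and> (\<forall>m. \<forall>s\<in>{0..r}. p m s \<le> q s)"
    and lim: "\<And>s. 0 \<le> s \<Longrightarrow> (\<lambda>m. p m s) \<longlonglongrightarrow> p' s"
  shows "r \<ge> 0 \<Longrightarrow> (\<lambda>m. radial_op N \<phi> \<gamma> (p m) r) \<longlonglongrightarrow> radial_op N \<phi> \<gamma> p' r"
    and "continuous_on {0..} (radial_op N \<phi> \<gamma> p')"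
proof -
  have flux: "(\<lambda>m. radial_flux N (p m) s) \<longlonglongrightarrow> radial_flux N p' s" if s: "s \<ge> 0" for s
  proof -
    obtain q where q: "continuous_on {0..} q" "\<And>m t. t \<in> {0..s} \<Longrightarrow> p m t \<le> q t"
      using dom[OF s] by blast
    have "(\<lambda>m. integral {0..s} (\<lambda>t. t ^ (N - 1) * p m t))
        \<longlonglongrightarrow> integral {0..s} (\<lambda>t. t ^ (N - 1) * p' t)"
    proof (rule dominated_convergence(2))
      show "(\<lambda>t. t ^ (N - 1) * p m t) integrable_on {0..s}" for m
        by (intro weighted_integrable cont)
      show "(\<lambda>t. t ^ (N - 1) * q t) integrable_on {0..s}"
        by (intro weighted_integrable q)
      show "norm (t ^ (N - 1) * p m t) \<le> t ^ (N - 1) * q t" if "t \<in> {0..s}" for m t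
        using q(2)[OF that] nonneg[of t m] that by (auto intro: mult_left_mono)
      show "(\<lambda>m. t ^ (N - 1) * p m t) \<longlonglongrightarrow> t ^ (N - 1) * p' t" if "t \<in> {0..s}" for t
        using that by (intro tendsto_intros lim) auto
    qed
    then show ?thesis unfolding radial_flux_def by (intro tendsto_intros)
  qed
  have slope: "(\<lambda>m. h_inv0 \<phi> (radial_flux N (p m) s)) \<longlonglongrightarrow> h_inv0 \<phi> (radial_flux N p' s)"
    if "s \<ge> 0" for s
    using continuous_on_tendsto_compose[OF h_inv0_continuous[OF assms(1), of UNIV] flux[OF that]]
    by simp
  have main: "(\<lambda>s. h_inv0 \<phi> (radial_flux N p' s)) integrable_on {0..r} \<and>
    (\<lambda>m. integral {0..r} (\<lambda>s. h_inv0 \<phi> (radial_flux N (p m) s)))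
      \<longlonglongrightarrow> integral {0..r} (\<lambda>s. h_inv0 \<phi> (radial_flux N p' s))" if r: "r \<ge> 0" for r
  proof -
    obtain q where q: "continuous_on {0..} q" "\<And>m t. t \<in> {0..r} \<Longrightarrow> p m t \<le> q t"
      using dom[OF r] by blast
    have "norm (h_inv0 \<phi> (radial_flux N (p m) s)) \<le> h_inv0 \<phi> (radial_flux N q s)"
      if "s \<in> {0..r}" for m s
      using that h_inv0_nonneg[OF assms(1) radial_flux_nonneg, of "p m" N s] nonneg
      by (auto intro!: h_inv0_mono[OF assms(1)] radial_flux_mono cont q)
    then show ?thesis
      using dominated_convergence[of "\<lambda>m s. h_inv0 \<phi> (radial_flux N (p m) s)" "{0..r}"
          "\<lambda>s. h_inv0 \<phi> (radial_flux N q s)" "\<lambda>s. h_inv0 \<phi> (radial_flux N p' s)"]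
        slope_integrable[OF assms(1,2) cont] slope_integrable[OF assms(1,2) q(1)] slope
      by auto
  qed
  show "(\<lambda>m. radial_op N \<phi> \<gamma> (p m) r) \<longlonglongrightarrow> radial_op N \<phi> \<gamma> p' r" if "r \<ge> 0"
    unfolding radial_op_def using main[OF that] by (intro tendsto_intros) auto
  have "continuous_on {0..b} (radial_op N \<phi> \<gamma> p')" if "b \<ge> 0" for b
    unfolding radial_op_def[abs_def] using main[OF that]
    by (intro continuous_intros indefinite_integral_continuous_1) auto
  then have *: "(radial_op N \<phi> \<gamma> p' \<longlongrightarrow> radial_op N \<phi> \<gamma> p' r) (at r within {0..r+1})" if "r \<ge> 0" for r
    using that by (auto simp: continuous_on_def)
  have "at r within {0..r+1} = at r within {0..}" for r :: real
    by (rule at_within_nhd[where S = "{..<r+1}"]) auto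
  then show "continuous_on {0..} (radial_op N \<phi> \<gamma> p')"
    unfolding continuous_on_def using * by auto
qed

section \<open>The radial profile solves the partial differential equation\<close>

lemma filterlim_norm_at_right_0:
  "filterlim norm (at_right 0) (at (0::'a::real_normed_vector))"
proof -
  have "(norm \<longlongrightarrow> 0) (at (0::'a))"
    by (rule tendsto_norm_zero[OF tendsto_ident_at])
  then show ?thesis unfolding filterlim_at by (simp add: eventually_at_filter)
qed

text \<open>At the origin the norm is not differentiable, and the vanishing one-sided derivative of \<open>u\<close>
  makes \<open>u(|x|) - u(0)\<close> of smaller order than \<open>|x|\<close>. The formula covers this case because
  \<open>sgn 0 = 0\<close>.\<close>

lemma GDERIV_radial:
  fixes x :: "'a::real_inner"
  assumes "\<And>r. r \<ge> 0 \<Longrightarrow> (u has_real_derivative u' r) (at r within {0..})" "u' 0 = 0"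
  shows "GDERIV (\<lambda>x. u (norm x)) x :> u' (norm x) *\<^sub>R sgn x"
proof (cases "x = 0")
  case False
  have "(u has_real_derivative u' (norm x)) (at (norm x))"
    using assms(1)[of "norm x"] False at_within_interior[of "norm x" "{0..}"] by simp
  then show ?thesis using GDERIV_DERIV_compose[OF GDERIV_norm[OF False]] by simp
next
  case True
  have "((\<lambda>r. (u r - u 0) / (r - 0)) \<longlongrightarrow> 0) (at_right 0)"
    using assms(1)[of 0] assms(2)
    by (simp add: has_field_derivative_iff at_within_Ici_at_right)
  then have "((\<lambda>h::'a. (u (norm h) - u 0) / (norm h - 0)) \<longlongrightarrow> 0) (at 0)"
    by (rule filterlim_compose[OF _ filterlim_norm_at_right_0])
  then have "((\<lambda>h::'a. norm ((u (norm h) - u 0) / norm h)) \<longlongrightarrow> 0) (at 0)"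
    using tendsto_norm_zero by fastforce
  then have "((\<lambda>x. u (norm x)) has_derivative (\<lambda>h. 0)) (at (0::'a))"
    by (simp add: has_derivative_at)
  then show ?thesis using True by (simp add: gderiv_def)
qed

text \<open>The derivative of \<open>q(|y|) y\<close> is \<open>q I\<close> plus the rank-one map with trace \<open>q' |x|\<close>.\<close>

lemma has_divergence_radial_field:
  fixes x :: "'a::euclidean_space"
  assumes "x \<noteq> 0" "(q has_real_derivative q') (at (norm x))"
  shows "has_divergence (\<lambda>y. q (norm y) *\<^sub>R y) (real DIM('a) * q (norm x) + q' * norm x) x"
proof -
  let ?D = "\<lambda>h. q (norm x) *\<^sub>R h + (h \<bullet> (q' *\<^sub>R sgn x)) *\<^sub>R x"
  have "((\<lambda>y. q (norm y)) has_derivative (\<lambda>h. h \<bullet> (q' *\<^sub>R sgn x))) (at x)"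
    using GDERIV_DERIV_compose[OF GDERIV_norm[OF assms(1)] assms(2)] by (simp add: gderiv_def)
  then have D: "((\<lambda>y. q (norm y) *\<^sub>R y) has_derivative ?D) (at x)"
    by (intro has_derivative_scaleR has_derivative_ident)
  have "?D b \<bullet> b = q (norm x) + q' * ((sgn x \<bullet> b) * (x \<bullet> b))" if "b \<in> Basis" for b
    using that by (simp add: inner_add_left inner_same_Basis inner_commute[of b "sgn x"])
  then have "(\<Sum>b\<in>Basis. ?D b \<bullet> b)
      = (\<Sum>b\<in>(Basis::'a set). q (norm x)) + q' * (\<Sum>b\<in>Basis. (sgn x \<bullet> b) * (x \<bullet> b))"
    by (simp add: sum.distrib sum_distrib_left)
  also have "(\<Sum>b\<in>Basis. (sgn x \<bullet> b) * (x \<bullet> b)) = sgn x \<bullet> x"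
    by (rule euclidean_inner[symmetric])
  also have "sgn x \<bullet> x = norm x"
    using assms(1) by (simp add: sgn_div_norm dot_square_norm power2_eq_square)
  finally show ?thesis unfolding has_divergence_def using D by (intro exI[of _ ?D]) simp
qed

text \<open>Differentiability at the origin needs only a limit of \<open>q\<close>, no derivative: the linear part
  is then \<open>l I\<close>, and the value \<open>q(0)\<close> is multiplied by the zero vector.\<close>

lemma has_divergence_radial_field_0:
  assumes "(q \<longlongrightarrow> l) (at_right 0)"
  shows "has_divergence (\<lambda>y::'a::euclidean_space. q (norm y) *\<^sub>R y) (real DIM('a) * l) 0"
proof -
  have "((\<lambda>r. q r - l) \<longlongrightarrow> 0) (at_right 0)"
    using assms by (simp add: LIM_zero)
  then have "((\<lambda>h::'a. q (norm h) - l) \<longlongrightarrow> 0) (at 0)"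
    by (rule filterlim_compose[OF _ filterlim_norm_at_right_0])
  then have 1: "((\<lambda>h::'a. norm (q (norm h) - l)) \<longlongrightarrow> 0) (at 0)"
    by (rule tendsto_norm_zero)
  have "eventually (\<lambda>h::'a. norm (q (norm h) - l)
      = norm (q (norm (0 + h)) *\<^sub>R (0 + h) - q (norm (0::'a)) *\<^sub>R 0 - l *\<^sub>R h) / norm h) (at 0)"
    by (auto simp: eventually_at_filter simp flip: scaleR_left_diff_distrib intro!: always_eventually)
  with 1 have "((\<lambda>h::'a. norm (q (norm (0 + h)) *\<^sub>R (0 + h) - q (norm (0::'a)) *\<^sub>R 0 - l *\<^sub>R h) / norm h)
      \<longlongrightarrow> 0) (at 0)"
    using Lim_transform_eventually by fastforce
  then have "((\<lambda>y::'a. q (norm y) *\<^sub>R y) has_derivative (\<lambda>h. l *\<^sub>R h)) (at 0)"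
    by (simp add: has_derivative_at bounded_linear_scaleR_right)
  then show ?thesis unfolding has_divergence_def
    by (intro exI[of _ "\<lambda>h. l *\<^sub>R h"]) simp
qed

text \<open>Since \<open>h_inv0\<close> inverts \<open>t \<mapsto> t \<phi>(t)\<close>, the field \<open>\<phi>(|\<nabla>u|) \<nabla>u\<close> is the flux times the radial
  unit vector, so the nonlinearity \<open>\<phi>\<close> cancels before the divergence is taken.\<close>

lemma radial_op_phi_laplacian:
  fixes x :: "'a::euclidean_space"
  assumes \<phi>: "phi_structure \<phi> kl ku \<theta>l \<theta>u \<psi>l \<psi>u" and N: "N = DIM('a)"
    and p: "continuous_on {0..} p" "\<And>s. 0 \<le> s \<Longrightarrow> p s \<ge> 0"
  shows "has_phi_laplacian \<phi> (\<lambda>x. radial_op N \<phi> \<gamma> p (norm x)) (p (norm x)) x"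
proof -
  have N1: "N \<ge> 1" using N by (simp add: Suc_leI)
  define G :: "'a \<Rightarrow> 'a" where "G y = h_inv0 \<phi> (radial_flux N p (norm y)) *\<^sub>R sgn y" for y
  have grad: "GDERIV (\<lambda>x. radial_op N \<phi> \<gamma> p (norm x)) y :> G y" for y :: 'a
    unfolding G_def
    by (rule GDERIV_radial) (use radial_op_deriv[OF \<phi> N1 p(1)] in \<open>auto simp: radial_flux_0 h_inv0_0\<close>)
  have field: "\<phi> (norm (G y)) *\<^sub>R G y = (radial_flux N p (norm y) / norm y) *\<^sub>R y" for y
  proof (cases "y = 0")
    case False
    have nn: "radial_flux N p (norm y) \<ge> 0" using p(2) by (rule radial_flux_nonneg)
    have "norm (G y) = h_inv0 \<phi> (radial_flux N p (norm y))"
      using False h_inv0_nonneg[OF \<phi> nn] by (simp add: G_def norm_sgn)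
    then show ?thesis
      using phi_h_inv0[OF \<phi> nn] by (simp add: G_def sgn_div_norm divide_inverse)
  qed (simp add: G_def)
  have "has_divergence (\<lambda>y::'a. (radial_flux N p (norm y) / norm y) *\<^sub>R y) (p (norm x)) x"
  proof (cases "x = 0")
    case True
    show ?thesis
      using has_divergence_radial_field_0[OF radial_flux_div_limit[OF p(1) N1], where 'a = 'a] N N1 True
      by simp
  next
    case False
    then show ?thesis
      using has_divergence_radial_field[OF False radial_flux_div_deriv[OF p(1) _ N1]] N
      by simp
  qed
  then show ?thesis
    unfolding has_phi_laplacian_def using grad field by (intro exI[of _ G]) simp
qed

section \<open>The solution operator of one equation\<close>

text \<open>The map that sends one unknown of the system to the other.\<close>

definition radial_map ::
  "nat \<Rightarrow> (real \<Rightarrow> real) \<Rightarrow> real \<Rightarrow> (real \<Rightarrow> real) \<Rightarrow> (real \<Rightarrow> real) \<Rightarrow> (real \<Rightarrow> real) \<Rightarrow> real \<Rightarrow> real"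
  where "radial_map N \<phi> \<gamma> a f w = radial_op N \<phi> \<gamma> (\<lambda>s. a s * f (w s))"

lemma cont_incr_nonneg_nonneg: "cont_incr_nonneg f \<Longrightarrow> x \<ge> 0 \<Longrightarrow> f x \<ge> 0"
  unfolding cont_incr_nonneg_def by (simp add: cont_nonneg_nonneg)

lemma source_continuous:
  assumes "cont_nonneg a" "cont_incr_nonneg f"
    and "continuous_on {0..} w" "\<And>s. s \<ge> 0 \<Longrightarrow> w s \<ge> 0"
  shows "continuous_on {0..} (\<lambda>s. a s * f (w s))"
proof (rule continuous_on_mult)
  show "continuous_on {0..} a" using assms(1) by (simp add: cont_nonneg_def)
  show "continuous_on {0..} (\<lambda>s. f (w s))"
    by (rule cont_nonneg_compose) (use assms in \<open>simp_all add: cont_incr_nonneg_def\<close>)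
qed

lemma source_nonneg:
  assumes "cont_nonneg a" "cont_incr_nonneg f" "\<And>s. s \<ge> 0 \<Longrightarrow> w s \<ge> 0" "s \<ge> 0"
  shows "a s * f (w s) \<ge> 0"
  by (intro mult_nonneg_nonneg cont_nonneg_nonneg[OF assms(1)] cont_incr_nonneg_nonneg[OF assms(2)]
      assms(3,4))

lemma radial_map_cong:
  assumes "\<And>s. s \<ge> 0 \<Longrightarrow> w s = w' s"
  shows "radial_map N \<phi> \<gamma> a f w r = radial_map N \<phi> \<gamma> a f w' r"
proof -
  have "radial_flux N (\<lambda>s. a s * f (w s)) t = radial_flux N (\<lambda>s. a s * f (w' s)) t" for t
    unfolding radial_flux_def using assms by (auto intro!: arg_cong2[where f = "(*)"] integral_cong)
  then show ?thesis unfolding radial_map_def radial_op_def by simp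
qed

context
  fixes N :: nat and \<gamma> kl ku :: real and \<phi> \<theta>l \<theta>u \<psi>l \<psi>u a f :: "real \<Rightarrow> real"
  assumes phi: "phi_structure \<phi> kl ku \<theta>l \<theta>u \<psi>l \<psi>u" and N1: "N \<ge> 1"
    and a: "cont_nonneg a" and f: "cont_incr_nonneg f"
begin

lemma radial_map_continuous:
  assumes "continuous_on {0..} w" "\<And>s. s \<ge> 0 \<Longrightarrow> w s \<ge> 0"
  shows "continuous_on {0..} (radial_map N \<phi> \<gamma> a f w)"
  unfolding radial_map_def
  by (rule radial_op_continuous[OF phi N1 source_continuous[OF a f assms]])

lemma radial_map_ge:
  assumes "continuous_on {0..} w" "\<And>s. s \<ge> 0 \<Longrightarrow> w s \<ge> 0" "r \<ge> 0"
  shows "radial_map N \<phi> \<gamma> a f w r \<ge> \<gamma>"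
  unfolding radial_map_def
  by (rule radial_op_ge[OF phi N1 source_continuous[OF a f assms(1,2)]
        source_nonneg[where w = w, OF a f assms(2)] assms(3)])

lemma radial_map_nonneg:
  assumes "\<gamma> > 0" "continuous_on {0..} w" "\<And>s. s \<ge> 0 \<Longrightarrow> w s \<ge> 0" "r \<ge> 0"
  shows "radial_map N \<phi> \<gamma> a f w r \<ge> 0"
  using radial_map_ge[OF assms(2-4)] assms(1) by simp

lemma radial_map_mono_on:
  assumes "continuous_on {0..} w" "\<And>s. s \<ge> 0 \<Longrightarrow> w s \<ge> 0"
  shows "mono_on {0..} (radial_map N \<phi> \<gamma> a f w)"
  unfolding radial_map_def
  by (rule radial_op_mono_on[OF phi N1 source_continuous[OF a f assms] source_nonneg[where w = w, OF a f assms(2)]])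

lemma radial_map_mono:
  assumes "continuous_on {0..} w" "continuous_on {0..} w'"
    and "\<And>s. s \<ge> 0 \<Longrightarrow> w s \<ge> 0" "\<And>s. s \<ge> 0 \<Longrightarrow> w s \<le> w' s"
  shows "radial_map N \<phi> \<gamma> a f w r \<le> radial_map N \<phi> \<gamma> a f w' r"
proof -
  have w': "w' s \<ge> 0" if "s \<ge> 0" for s
    using assms(3,4)[OF that] by linarith
  show ?thesis
    unfolding radial_map_def
  proof (rule radial_op_mono[OF phi N1 source_continuous[OF a f assms(1,3)]
        source_continuous[OF a f assms(2) w']])
    show "a s * f (w s) \<le> a s * f (w' s)" if "s \<ge> 0" for s
      by (intro mult_left_mono cont_incr_nonneg_mono[OF f] assms(3,4) cont_nonneg_nonneg[OF a] that)
  qed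
qed

text \<open>On \<open>[0,r]\<close> the sources are dominated by \<open>a(s) f(K)\<close>, because \<open>f\<close> is increasing.\<close>

lemma radial_map_limit:
  assumes cont: "\<And>m. continuous_on {0..} (w m)"
    and nonneg: "\<And>m s. s \<ge> 0 \<Longrightarrow> w m s \<ge> 0"
    and bdd: "\<And>r. r \<ge> 0 \<Longrightarrow> \<exists>K. \<forall>m. \<forall>s\<in>{0..r}. w m s \<le> K"
    and lim: "\<And>s. s \<ge> 0 \<Longrightarrow> (\<lambda>m. w m s) \<longlonglongrightarrow> w' s"
  shows "r \<ge> 0 \<Longrightarrow> (\<lambda>m. radial_map N \<phi> \<gamma> a f (w m) r) \<longlonglongrightarrow> radial_map N \<phi> \<gamma> a f w' r"
    and "continuous_on {0..} (radial_map N \<phi> \<gamma> a f w')"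
proof -
  have w': "w' s \<ge> 0" if "s \<ge> 0" for s
    by (rule LIMSEQ_le_const[OF lim[OF that]]) (simp add: nonneg that)
  have dom: "\<exists>q. continuous_on {0..} q \<and> (\<forall>m. \<forall>s\<in>{0..r}. a s * f (w m s) \<le> q s)" if r: "r \<ge> 0" for r
  proof -
    obtain K where K: "\<And>m s. s \<in> {0..r} \<Longrightarrow> w m s \<le> K" using bdd[OF r] by blast
    have "a s * f (w m s) \<le> a s * f K" if "s \<in> {0..r}" for m s
      by (intro mult_left_mono cont_incr_nonneg_mono[OF f] nonneg K cont_nonneg_nonneg[OF a])
        (use that in auto)
    moreover have "continuous_on {0..} (\<lambda>s. a s * f K)"
      using a unfolding cont_nonneg_def by (intro continuous_on_mult continuous_on_const) simp
    ultimately show ?thesis by blast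
  qed
  have lim': "(\<lambda>m. a s * f (w m s)) \<longlonglongrightarrow> a s * f (w' s)" if "s \<ge> 0" for s
  proof (rule tendsto_mult[OF tendsto_const])
    have "continuous_on {0..} f" using f by (simp add: cont_incr_nonneg_def cont_nonneg_def)
    then show "(\<lambda>m. f (w m s)) \<longlonglongrightarrow> f (w' s)"
      by (rule continuous_on_tendsto_compose[OF _ lim[OF that]]) (simp_all add: nonneg w' that)
  qed
  have src: "continuous_on {0..} (\<lambda>s. a s * f (w m s))" "s \<ge> 0 \<Longrightarrow> a s * f (w m s) \<ge> 0" for m s
    by (rule source_continuous[OF a f cont nonneg], assumption)
      (rule source_nonneg[where w = "w m", OF a f nonneg], assumption+)
  note L = radial_op_limit[where p = "\<lambda>m s. a s * f (w m s)", OF phi N1 src dom lim']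
  show "r \<ge> 0 \<Longrightarrow> (\<lambda>m. radial_map N \<phi> \<gamma> a f (w m) r) \<longlonglongrightarrow> radial_map N \<phi> \<gamma> a f w' r"
    unfolding radial_map_def by (rule L(1))
  show "continuous_on {0..} (radial_map N \<phi> \<gamma> a f w')"
    unfolding radial_map_def by (rule L(2))
qed

end

section \<open>The a priori bound\<close>

lemma A_bar_eq: "A_bar N k \<psi> a t = integral {0..t} (\<lambda>s. k * \<psi> (radial_flux N a s))"
  by (simp add: A_bar_def radial_flux_def)

lemma P_bar_eq:
  "P_bar N c \<psi> \<xi> a A r
    = integral {0..r} (\<lambda>y. \<psi> (c * radial_flux N (\<lambda>t. a t * \<xi> (1 + A t)) y))"
  by (simp add: P_bar_def radial_flux_def mult.assoc)

lemma integral_upper_deriv: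
  fixes k :: "real \<Rightarrow> real"
  assumes "continuous_on {a..} k" "x \<ge> a"
  shows "((\<lambda>x. integral {a..x} k) has_real_derivative k x) (at x within {a..})"
proof -
  have "((\<lambda>x. integral {a..x} k) has_real_derivative k x) (at x within {a..x+1})"
    by (rule integral_has_real_derivative) (use assms in \<open>auto intro: continuous_on_subset\<close>)
  moreover have "at x within {a..x+1} = at x within {a..}"
    by (rule at_within_nhd[where S = "{..<x+1}"]) auto
  ultimately show ?thesis by simp
qed

lemma integral_upper_continuous:
  fixes k :: "real \<Rightarrow> real"
  assumes "continuous_on {a..} k"
  shows "continuous_on {a..} (\<lambda>x. integral {a..x} k)"
  by (rule DERIV_continuous_on) (rule integral_upper_deriv[OF assms], simp)

lemma integral_upper_mono:
  fixes k :: "real \<Rightarrow> real"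
  assumes "continuous_on {a..} k" "\<And>x. x \<ge> a \<Longrightarrow> k x \<ge> 0" "x \<le> y"
  shows "integral {a..x} k \<le> integral {a..y} k"
proof (rule integral_subset_le)
  show "k integrable_on {a..x}" "k integrable_on {a..y}"
    by (rule integrable_continuous_real[OF continuous_on_subset[OF assms(1)]]; simp)+
qed (use assms in auto)

lemma mono_on_bounded_tendsto:
  fixes u :: "real \<Rightarrow> real"
  assumes "\<And>r. r \<ge> 0 \<Longrightarrow> u r \<le> K" "mono_on {0..} u"
  shows "\<exists>l. (u \<longlongrightarrow> l) at_top"
proof -
  have bdd: "bdd_above (u ` {0..})" using assms(1) by (auto simp: bdd_above_def)
  have "(u \<longlongrightarrow> Sup (u ` {0..})) at_top"
  proof (rule increasing_tendsto)
    show "eventually (\<lambda>r. u r \<le> Sup (u ` {0..})) at_top"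
      using eventually_ge_at_top[of "0::real"] by eventually_elim (auto intro!: cSup_upper bdd)
    fix x assume "x < Sup (u ` {0..})"
    then obtain r where r: "r \<ge> 0" "x < u r"
      using less_cSup_iff[OF _ bdd] by auto
    show "eventually (\<lambda>s. x < u s) at_top"
      using eventually_ge_at_top[of r]
    proof eventually_elim
      case (elim s)
      then have "u r \<le> u s" using r(1) by (intro mono_onD[OF assms(2)]) simp_all
      then show ?case using r(2) by simp
    qed
  qed
  then show ?thesis ..
qed

text \<open>The data of both equations, but the growth condition and the divergent integral of the first
  one only. The growth condition of the second equation enters through the interpretation in
  which the equations are exchanged.\<close>

locale keller_osserman =
  fixes N :: nat
    and \<alpha> \<beta> kl1 ku1 kl2 ku2 M c :: real
    and \<phi>1 \<phi>2 \<theta>l1 \<theta>u1 \<theta>l2 \<theta>u2 \<psi>l1 \<psi>u1 \<psi>l2 \<psi>u2 :: "real \<Rightarrow> real"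
    and a1 a2 f1 f2 g \<xi> :: "real \<Rightarrow> real"
  assumes N1: "N \<ge> 1" and alpha: "\<alpha> > 0" and beta: "\<beta> > 0"
    and phi1: "phi_structure \<phi>1 kl1 ku1 \<theta>l1 \<theta>u1 \<psi>l1 \<psi>u1"
    and phi2: "phi_structure \<phi>2 kl2 ku2 \<theta>l2 \<theta>u2 \<psi>l2 \<psi>u2"
    and a1: "cont_nonneg a1" and a2: "cont_nonneg a2"
    and f1: "cont_incr_nonneg f1" and f2: "cont_incr_nonneg f2"
    and f1_pos: "\<And>s. s > 0 \<Longrightarrow> f1 s > 0" and f2_pos: "\<And>s. s > 0 \<Longrightarrow> f2 s > 0"
    and M1: "M \<ge> 1" and M_beta: "\<beta> \<le> M * \<theta>u2 (f2 \<alpha>)" and c: "c > 0"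
    and g: "cont_incr_nonneg g" and xi: "cont_nonneg \<xi>"
    and growth: "\<And>w t. w \<ge> 1 \<Longrightarrow> t \<ge> M * \<theta>u2 (f2 \<alpha>) \<Longrightarrow> f1 (t * w) \<le> c * g t * \<xi> w"
    and H_infinite: "filterlim (H_fun \<alpha> \<theta>u1 g M \<theta>u2 f2) at_top at_top"
begin

abbreviation "T1 \<equiv> radial_map N \<phi>1 \<alpha> a1 f1"
abbreviation "T2 \<equiv> radial_map N \<phi>2 \<beta> a2 f2"
abbreviation "A \<equiv> A_bar N ku2 \<psi>u2 a2"
abbreviation "P \<equiv> P_bar N c \<psi>u1 \<xi> a1 A"
abbreviation "B t \<equiv> M * \<theta>u2 (f2 t)"
abbreviation "H \<equiv> H_fun \<alpha> \<theta>u1 g M \<theta>u2 f2"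

lemma theta1: "cont_incr_nonneg \<theta>u1" and psi1: "cont_nonneg \<psi>u1" and ku1: "ku1 > 0"
  using phi1 unfolding phi_structure_def by auto

lemma theta2: "cont_incr_nonneg \<theta>u2" and psi2: "cont_nonneg \<psi>u2" and ku2: "ku2 > 0"
  using phi2 unfolding phi_structure_def by auto

lemma B_mono: "0 \<le> s \<Longrightarrow> s \<le> t \<Longrightarrow> B s \<le> B t"
  using M1 by (intro mult_left_mono cont_incr_nonneg_mono[OF theta2] cont_incr_nonneg_mono[OF f2]
      cont_incr_nonneg_nonneg[OF f2]) simp_all

lemma B_pos: "s > 0 \<Longrightarrow> B s > 0"
  using M1 theta_upper_pos[OF phi2 f2_pos] by simp

text \<open>The growth condition at \<open>w = 1\<close> bounds the positive number \<open>f1 (B s)\<close> by a multiple of \<open>g (B s)\<close>.\<close>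

lemma g_B_pos:
  assumes "s \<ge> \<alpha>"
  shows "g (B s) > 0"
proof -
  have s: "s > 0" using assms alpha by simp
  have "0 < f1 (B s * 1)" using f1_pos[OF B_pos[OF s]] by simp
  also have "\<dots> \<le> c * g (B s) * \<xi> 1"
    using B_mono[OF less_imp_le[OF alpha] assms] by (intro growth) simp_all
  finally have "g (B s) \<noteq> 0" by auto
  moreover have "g (B s) \<ge> 0"
    using B_pos[OF s] by (intro cont_incr_nonneg_nonneg[OF g]) simp
  ultimately show ?thesis by simp
qed

lemma H_integrand_pos: "s \<ge> \<alpha> \<Longrightarrow> \<theta>u1 (g (B s)) > 0"
  by (rule theta_upper_pos[OF phi1 g_B_pos])

lemma H_integrand_continuous: "continuous_on {\<alpha>..} (\<lambda>t. 1 / \<theta>u1 (g (B t)))"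
proof -
  have cn: "cont_nonneg \<theta>u1" "cont_nonneg g" "cont_nonneg \<theta>u2" "cont_nonneg f2"
    using theta1 g theta2 f2 by (simp_all add: cont_incr_nonneg_def)
  have pos: "0 < t" if "t \<in> {\<alpha>..}" for t using that alpha by simp
  have 1: "continuous_on {\<alpha>..} (\<lambda>t. f2 t)"
    by (rule cont_nonneg_compose[OF cn(4) continuous_on_id]) (use pos in force)
  have 2: "continuous_on {\<alpha>..} (\<lambda>t. \<theta>u2 (f2 t))"
    by (rule cont_nonneg_compose[OF cn(3) 1]) (use f2_pos[OF pos] in force)
  have 3: "continuous_on {\<alpha>..} B"
    by (rule continuous_on_mult[OF continuous_on_const 2])
  have 4: "continuous_on {\<alpha>..} (\<lambda>t. g (B t))"
    by (rule cont_nonneg_compose[OF cn(2) 3]) (use B_pos[OF pos] in force)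
  have 5: "continuous_on {\<alpha>..} (\<lambda>t. \<theta>u1 (g (B t)))"
    by (rule cont_nonneg_compose[OF cn(1) 4]) (use g_B_pos in force)
  show ?thesis
    by (rule continuous_on_divide[OF continuous_on_const 5]) (use H_integrand_pos in force)
qed

lemma a2_flux_nonneg: "radial_flux N a2 s \<ge> 0"
  by (rule radial_flux_nonneg[OF cont_nonneg_nonneg[OF a2]])

lemma A_integrand_continuous: "continuous_on {0..} (\<lambda>s. ku2 * \<psi>u2 (radial_flux N a2 s))"
proof -
  have "continuous_on {0..} (radial_flux N a2)"
    using a2 N1 by (intro radial_flux_continuous) (simp_all add: cont_nonneg_def)
  then show ?thesis
    by (intro continuous_on_mult[OF continuous_on_const] cont_nonneg_compose[OF psi2]
        a2_flux_nonneg)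
qed

lemma A_nonneg: "A t \<ge> 0"
  unfolding A_bar_eq
  using ku2 cont_nonneg_nonneg[OF psi2 a2_flux_nonneg]
  by (intro integral_nonneg integrable_continuous_real
      continuous_on_subset[OF A_integrand_continuous]) auto

lemma P_source_continuous: "continuous_on {0..} (\<lambda>t. a1 t * \<xi> (1 + A t))"
proof (rule continuous_on_mult)
  show "continuous_on {0..} a1" using a1 by (simp add: cont_nonneg_def)
  have "continuous_on {0..} A"
    unfolding A_bar_eq[abs_def] by (rule integral_upper_continuous[OF A_integrand_continuous])
  then have "continuous_on {0..} (\<lambda>t. 1 + A t)" by (rule continuous_on_add[OF continuous_on_const])
  then show "continuous_on {0..} (\<lambda>t. \<xi> (1 + A t))"
    by (rule cont_nonneg_compose[OF xi]) (simp add: A_nonneg add_nonneg_nonneg)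
qed

lemma P_flux_nonneg: "c * radial_flux N (\<lambda>t. a1 t * \<xi> (1 + A t)) y \<ge> 0"
  using c A_nonneg
  by (intro mult_nonneg_nonneg radial_flux_nonneg cont_nonneg_nonneg[OF a1] cont_nonneg_nonneg[OF xi])
    (simp_all add: add_nonneg_nonneg)

lemma P_integrand_continuous:
  "continuous_on {0..} (\<lambda>y. \<psi>u1 (c * radial_flux N (\<lambda>t. a1 t * \<xi> (1 + A t)) y))"
  by (rule cont_nonneg_compose[OF psi1 continuous_on_mult[OF continuous_on_const
          radial_flux_continuous[OF P_source_continuous N1]] P_flux_nonneg])

lemma P_mono: "r \<le> s \<Longrightarrow> P r \<le> P s"
  unfolding P_bar_eq
  by (rule integral_upper_mono[OF P_integrand_continuous]) (rule cont_nonneg_nonneg[OF psi1 P_flux_nonneg])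

text \<open>The bounds are proved for every \<open>w\<close> that lies below its image under \<open>T1 \<circ> T2\<close>. Iterates and
  fixed points both have this property.\<close>

context
  fixes w :: "real \<Rightarrow> real"
  assumes w_cont: "continuous_on {0..} w" and w_nonneg: "\<And>s. s \<ge> 0 \<Longrightarrow> w s \<ge> 0"
    and w_le: "\<And>s. s \<ge> 0 \<Longrightarrow> w s \<le> T1 (T2 w) s"
begin

lemma T2_w_cont: "continuous_on {0..} (T2 w)"
  by (rule radial_map_continuous[OF phi2 N1 a2 f2 w_cont w_nonneg])

lemma T2_w_nonneg: "s \<ge> 0 \<Longrightarrow> T2 w s \<ge> 0"
  by (rule radial_map_nonneg[OF phi2 N1 a2 f2 beta w_cont w_nonneg])

lemma u_mono: "0 \<le> s \<Longrightarrow> s \<le> t \<Longrightarrow> T1 (T2 w) s \<le> T1 (T2 w) t"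
  using radial_map_mono_on[OF phi1 N1 a1 f1 T2_w_cont T2_w_nonneg]
  by (auto simp: mono_on_def)

lemma u_ge: "s \<ge> 0 \<Longrightarrow> T1 (T2 w) s \<ge> \<alpha>"
  by (rule radial_map_ge[OF phi1 N1 a1 f1 T2_w_cont T2_w_nonneg])

lemma f2_u_pos: "s \<ge> 0 \<Longrightarrow> f2 (T1 (T2 w) s) > 0"
  using u_ge[of s] alpha by (intro f2_pos) simp

text \<open>For \<open>t \<le> r\<close> the factor \<open>f2 (w t)\<close> is at most \<open>f2 (u r)\<close> with \<open>u = T1 (T2 w)\<close>, so it leaves the
  integrals, and the upper bound for \<open>h_inv\<close> turns it into \<open>\<theta>u2 (f2 (u r))\<close>. The choice of \<open>M\<close> absorbs
  the initial value \<open>\<beta>\<close> into the same factor, so that the bound has the form of the argument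
  \<open>t w\<close> of the growth condition.\<close>

lemma inner_bound:
  assumes r: "r \<ge> 0"
  shows "T2 w r \<le> B (T1 (T2 w) r) * (1 + A r)"
proof -
  let ?u = "T1 (T2 w)"
  let ?th = "\<theta>u2 (f2 (?u r))"
  have th: "?th > 0" by (rule theta_upper_pos[OF phi2 f2_u_pos[OF r]])
  have a2c: "continuous_on {0..} a2" using a2 by (simp add: cont_nonneg_def)
  have src: "continuous_on {0..} (\<lambda>s. a2 s * f2 (w s))"
    by (rule source_continuous[OF a2 f2 w_cont w_nonneg])
  have slope: "h_inv0 \<phi>2 (radial_flux N (\<lambda>s. a2 s * f2 (w s)) s)
      \<le> ?th * (ku2 * \<psi>u2 (radial_flux N a2 s))" if s: "s \<in> {0..r}" for s
  proof -
    have "radial_flux N (\<lambda>s. a2 s * f2 (w s)) s \<le> radial_flux N (\<lambda>s. f2 (?u r) * a2 s) s"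
    proof (rule radial_flux_mono[OF src continuous_on_mult[OF continuous_on_const a2c]])
      fix t assume t: "0 \<le> t" "t \<le> s"
      have "w t \<le> ?u r" using w_le[OF t(1)] u_mono[of t r] t s by simp
      then have "f2 (w t) \<le> f2 (?u r)" by (rule cont_incr_nonneg_mono[OF f2 w_nonneg[OF t(1)]])
      then show "a2 t * f2 (w t) \<le> f2 (?u r) * a2 t"
        using cont_nonneg_nonneg[OF a2 t(1)] by (simp add: mult.commute mult_left_mono)
    qed
    also have "\<dots> = f2 (?u r) * radial_flux N a2 s" by (rule radial_flux_cmult)
    finally have "h_inv0 \<phi>2 (radial_flux N (\<lambda>s. a2 s * f2 (w s)) s)
        \<le> h_inv0 \<phi>2 (f2 (?u r) * radial_flux N a2 s)"
      by (rule h_inv0_mono[OF phi2])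
    also have "\<dots> \<le> ku2 * ?th * \<psi>u2 (radial_flux N a2 s)"
      by (rule h_inv0_mult_le[OF phi2 f2_u_pos[OF r] a2_flux_nonneg])
    finally show ?thesis by (simp add: mult_ac)
  qed
  have "integral {0..r} (\<lambda>s. h_inv0 \<phi>2 (radial_flux N (\<lambda>s. a2 s * f2 (w s)) s))
      \<le> integral {0..r} (\<lambda>s. ?th * (ku2 * \<psi>u2 (radial_flux N a2 s)))"
    by (rule integral_le[OF slope_integrable[OF phi2 N1 src] _ slope])
      (rule integrable_continuous_real[OF continuous_on_subset[OF
            continuous_on_mult[OF continuous_on_const A_integrand_continuous]]], simp)
  then have "T2 w r \<le> \<beta> + ?th * A r"
    unfolding radial_map_def radial_op_def A_bar_eq by simp
  also have "\<dots> \<le> B (?u r) + B (?u r) * A r"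
  proof (rule add_mono)
    show "\<beta> \<le> B (?u r)"
      using M_beta B_mono[OF less_imp_le[OF alpha] u_ge[OF r]] by simp
    show "?th * A r \<le> B (?u r) * A r"
      using M1 th A_nonneg[of r] by (intro mult_right_mono) simp_all
  qed
  finally show ?thesis by (simp add: distrib_left)
qed

text \<open>The growth condition applied to \<open>inner_bound\<close> splits \<open>f1 (T2 w t)\<close> into \<open>g (B (u t))\<close> and the source
  of \<open>P\<close>. The first factor is increasing in \<open>t\<close>, so it leaves the flux integral with its value
  at \<open>r\<close>.\<close>

lemma outer_slope_bound:
  assumes r: "r \<ge> 0"
  shows "h_inv0 \<phi>1 (radial_flux N (\<lambda>s. a1 s * f1 (T2 w s)) r)
    \<le> ku1 * \<theta>u1 (g (B (T1 (T2 w) r))) * \<psi>u1 (c * radial_flux N (\<lambda>t. a1 t * \<xi> (1 + A t)) r)"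
proof -
  let ?u = "T1 (T2 w)"
  let ?G = "g (B (?u r))"
  have "radial_flux N (\<lambda>s. a1 s * f1 (T2 w s)) r
      \<le> radial_flux N (\<lambda>s. (?G * c) * (a1 s * \<xi> (1 + A s))) r"
  proof (rule radial_flux_mono[OF source_continuous[OF a1 f1 T2_w_cont T2_w_nonneg]
        continuous_on_mult[OF continuous_on_const P_source_continuous]])
    fix t assume t: "0 \<le> t" "t \<le> r"
    have u0: "?u t > 0" using u_ge[OF t(1)] alpha by simp
    have xi0: "\<xi> (1 + A t) \<ge> 0" using A_nonneg[of t] by (intro cont_nonneg_nonneg[OF xi]) simp
    have "f1 (T2 w t) \<le> f1 (B (?u t) * (1 + A t))"
      by (rule cont_incr_nonneg_mono[OF f1 T2_w_nonneg[OF t(1)] inner_bound[OF t(1)]])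
    also have "\<dots> \<le> c * g (B (?u t)) * \<xi> (1 + A t)"
      using B_mono[OF less_imp_le[OF alpha] u_ge[OF t(1)]] A_nonneg[of t] by (intro growth) simp_all
    also have "\<dots> \<le> c * ?G * \<xi> (1 + A t)"
    proof -
      have "B (?u t) \<le> B (?u r)" using u0 by (intro B_mono u_mono t) simp
      then have "g (B (?u t)) \<le> ?G"
        by (rule cont_incr_nonneg_mono[OF g less_imp_le[OF B_pos[OF u0]]])
      then show ?thesis using c xi0 by (intro mult_right_mono mult_left_mono) simp_all
    qed
    finally have "a1 t * f1 (T2 w t) \<le> a1 t * (c * ?G * \<xi> (1 + A t))"
      by (rule mult_left_mono[OF _ cont_nonneg_nonneg[OF a1 t(1)]])
    then show "a1 t * f1 (T2 w t) \<le> (?G * c) * (a1 t * \<xi> (1 + A t))" by (simp add: mult_ac)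
  qed
  also have "\<dots> = ?G * (c * radial_flux N (\<lambda>t. a1 t * \<xi> (1 + A t)) r)"
    by (simp only: radial_flux_cmult mult.assoc)
  finally have "h_inv0 \<phi>1 (radial_flux N (\<lambda>s. a1 s * f1 (T2 w s)) r)
      \<le> h_inv0 \<phi>1 (?G * (c * radial_flux N (\<lambda>t. a1 t * \<xi> (1 + A t)) r))"
    by (rule h_inv0_mono[OF phi1])
  also have "\<dots> \<le> ku1 * \<theta>u1 ?G * \<psi>u1 (c * radial_flux N (\<lambda>t. a1 t * \<xi> (1 + A t)) r)"
    by (rule h_inv0_mult_le[OF phi1 g_B_pos[OF u_ge[OF r]] P_flux_nonneg])
  finally show ?thesis .
qed

text \<open>Separation of variables: \<open>outer_slope_bound\<close> says that the derivative of \<open>H \<circ> T1 (T2 w)\<close> is at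
  most that of \<open>ku1 * P\<close>, and both functions vanish at \<open>0\<close>.\<close>

lemma H_bound:
  assumes r: "r \<ge> 0"
  shows "H (T1 (T2 w) r) \<le> ku1 * P r"
proof -
  let ?u = "T1 (T2 w)"
  let ?k = "\<lambda>t. 1 / \<theta>u1 (g (B t))"
  let ?p = "\<lambda>y. \<psi>u1 (c * radial_flux N (\<lambda>t. a1 t * \<xi> (1 + A t)) y)"
  let ?u' = "\<lambda>s. h_inv0 \<phi>1 (radial_flux N (\<lambda>s. a1 s * f1 (T2 w s)) s)"
  have D: "((\<lambda>s. ku1 * P s - H (?u s)) has_real_derivative ku1 * ?p s - ?k (?u s) * ?u' s)
      (at s within {0..})" if s: "s \<ge> 0" for s
  proof -
    have "(H has_real_derivative ?k (?u s)) (at (?u s) within {\<alpha>..})"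
      unfolding H_fun_def[abs_def]
      by (rule integral_upper_deriv[OF H_integrand_continuous u_ge[OF s]])
    then have "(H has_real_derivative ?k (?u s)) (at (?u s) within ?u ` {0..})"
      by (rule DERIV_subset) (use u_ge in auto)
    moreover have "(?u has_real_derivative ?u' s) (at s within {0..})"
      unfolding radial_map_def[of N \<phi>1 \<alpha> a1 f1]
      by (rule radial_op_deriv[OF phi1 N1 source_continuous[OF a1 f1 T2_w_cont T2_w_nonneg] s])
    ultimately have "((\<lambda>s. H (?u s)) has_real_derivative ?k (?u s) * ?u' s) (at s within {0..})"
      using DERIV_image_chain[of H "?k (?u s)" ?u s "{0..}" "?u' s"] by (simp add: o_def)
    moreover have "(P has_real_derivative ?p s) (at s within {0..})"
      unfolding P_bar_eq[abs_def] by (rule integral_upper_deriv[OF P_integrand_continuous s])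
    ultimately show ?thesis by (intro DERIV_diff DERIV_cmult)
  qed
  have nonneg: "ku1 * ?p s - ?k (?u s) * ?u' s \<ge> 0" if s: "s \<ge> 0" for s
    using outer_slope_bound[OF s] H_integrand_pos[OF u_ge[OF s]]
    by (simp add: field_simps)
  have "ku1 * P 0 - H (?u 0) \<le> ku1 * P r - H (?u r)"
  proof (rule DERIV_nonneg_imp_increasing_open[OF r])
    fix s assume s: "0 < s" "s < r"
    have "at s within {0..} = at s" using s at_within_interior[of s "{0..}"] by simp
    then show "\<exists>y. ((\<lambda>s. ku1 * P s - H (?u s)) has_real_derivative y) (at s) \<and> 0 \<le> y"
      using D[of s] nonneg[of s] s by auto
  next
    have "continuous_on {0..} (\<lambda>s. ku1 * P s - H (?u s))"
      by (rule DERIV_continuous_on) (rule D, simp)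
    then show "continuous_on {0..r} (\<lambda>s. ku1 * P s - H (?u s))"
      by (rule continuous_on_subset) simp
  qed
  moreover have "?u 0 = \<alpha>" by (simp add: radial_map_def radial_op_0)
  ultimately show ?thesis by (simp add: P_bar_def H_fun_def)
qed

end

lemma H_bounded_imp_bounded:
  obtains K where "\<And>x. H x \<le> L \<Longrightarrow> x \<le> K"
proof -
  have "eventually (\<lambda>x. L < H x) at_top"
    using H_infinite by (simp add: filterlim_at_top_dense)
  then obtain K where "\<And>x. x \<ge> K \<Longrightarrow> L < H x"
    unfolding eventually_at_top_linorder by blast
  then show ?thesis using that[of K] by (meson not_less linear)
qed

text \<open>A bounded \<open>P\<close> bounds \<open>H \<circ> u\<close>, hence \<open>u\<close>, which is increasing.\<close>

lemma fixed_point_limit: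
  assumes "continuous_on {0..} u" "\<And>s. s \<ge> 0 \<Longrightarrow> u s \<ge> 0"
    and "\<And>s. s \<ge> 0 \<Longrightarrow> u s = T1 (T2 u) s"
    and P: "(P \<longlongrightarrow> L) at_top"
  shows "\<exists>l. (u \<longlongrightarrow> l) at_top"
proof -
  have le: "\<And>s. s \<ge> 0 \<Longrightarrow> u s \<le> T1 (T2 u) s" using assms(3) by simp
  obtain K where K: "\<And>x. H x \<le> ku1 * L \<Longrightarrow> x \<le> K" using H_bounded_imp_bounded by blast
  have "u r \<le> K" if r: "r \<ge> 0" for r
  proof -
    have "P r \<le> L"
      by (rule tendsto_lowerbound[OF P])
        (auto intro: eventually_mono[OF eventually_ge_at_top[of r]] P_mono)
    then have "H (u r) \<le> ku1 * L"
      using H_bound[OF assms(1,2) le r] assms(3)[OF r] ku1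
      by (smt (verit) mult_left_mono)
    then show ?thesis by (rule K)
  qed
  moreover have "mono_on {0..} u"
    using u_mono[OF assms(1,2) le] assms(3) by (auto simp: mono_on_def)
  ultimately show ?thesis by (rule mono_on_bounded_tendsto)
qed

text \<open>Monotone iteration from the constant \<open>\<alpha>\<close>, the smallest value of \<open>T1\<close>. Pointwise convergence
  follows from the bound on \<open>[0,r]\<close>, which \<open>H_bound\<close> makes independent of the step.\<close>

lemma fixed_point_exists:
  obtains u where "continuous_on {0..} u" "\<And>s. s \<ge> 0 \<Longrightarrow> u s \<ge> \<alpha>"
    "\<And>s. s \<ge> 0 \<Longrightarrow> u s = T1 (T2 u) s"
proof -
  define U where "U m = ((\<lambda>w. T1 (T2 w)) ^^ m) (\<lambda>_. \<alpha>)" for m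
  have U0: "U 0 = (\<lambda>_. \<alpha>)" and US: "U (Suc m) = T1 (T2 (U m))" for m by (simp_all add: U_def)
  have U: "continuous_on {0..} (U m) \<and> (\<forall>s\<ge>0. U m s \<ge> \<alpha>)" for m
  proof (induction m)
    case 0
    then show ?case by (simp add: U0)
  next
    case (Suc m)
    then have *: "continuous_on {0..} (U m)" "\<And>s. s \<ge> 0 \<Longrightarrow> U m s \<ge> 0"
      using alpha by (auto intro: order_trans[OF less_imp_le])
    note 2 = radial_map_continuous[OF phi2 N1 a2 f2 *] radial_map_nonneg[OF phi2 N1 a2 f2 beta *]
    show ?case
      unfolding US
      using radial_map_continuous[OF phi1 N1 a1 f1 2] radial_map_ge[OF phi1 N1 a1 f1 2]
      by simp
  qed
  have Uc: "continuous_on {0..} (U m)" for m using U by simp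
  have Ua: "s \<ge> 0 \<Longrightarrow> U m s \<ge> \<alpha>" for m s using U by simp
  have Un: "s \<ge> 0 \<Longrightarrow> U m s \<ge> 0" for m s using Ua[of s m] alpha by simp
  have Vc: "continuous_on {0..} (T2 (U m))" for m
    by (rule radial_map_continuous[OF phi2 N1 a2 f2 Uc Un])
  have Vn: "s \<ge> 0 \<Longrightarrow> T2 (U m) s \<ge> 0" for m s
    by (rule radial_map_nonneg[OF phi2 N1 a2 f2 beta Uc Un])
  have incr: "s \<ge> 0 \<Longrightarrow> U m s \<le> U (Suc m) s" for m s
  proof (induction m arbitrary: s)
    case 0
    then show ?case using Ua[of s 1] by (simp add: U0)
  next
    case (Suc m)
    have "T2 (U m) t \<le> T2 (U (Suc m)) t" for t
      by (rule radial_map_mono[OF phi2 N1 a2 f2 Uc Uc Un Suc.IH])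
    then have "T1 (T2 (U m)) s \<le> T1 (T2 (U (Suc m))) s"
      by (intro radial_map_mono[OF phi1 N1 a1 f1 Vc Vc Vn])
    then show ?case by (simp only: US)
  qed
  have bdd: "\<exists>K. \<forall>m. \<forall>s\<in>{0..r}. U m s \<le> K" if r: "r \<ge> 0" for r
  proof -
    obtain K where K: "\<And>x. H x \<le> ku1 * P r \<Longrightarrow> x \<le> K" using H_bounded_imp_bounded by blast
    have "U m s \<le> K" if s: "s \<in> {0..r}" for m s
    proof -
      have le: "t \<ge> 0 \<Longrightarrow> U m t \<le> T1 (T2 (U m)) t" for t using incr[of t m] by (simp add: US)
      have "U m s \<le> T1 (T2 (U m)) s" using le s by simp
      also have "\<dots> \<le> T1 (T2 (U m)) r" using u_mono[OF Uc Un le, of s r] s by simp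
      also have "\<dots> \<le> K" by (rule K[OF H_bound[OF Uc Un le r]])
      finally show ?thesis .
    qed
    then show ?thesis by blast
  qed
  define u where "u s = lim (\<lambda>m. U m s)" for s
  have lim: "(\<lambda>m. U m s) \<longlonglongrightarrow> u s" if s: "s \<ge> 0" for s
  proof -
    obtain K where "\<And>m. U m s \<le> K" using bdd[OF s] s by (meson atLeastAtMost_iff order_refl)
    then have "convergent (\<lambda>m. U m s)"
      using incseq_convergent[OF incseq_SucI[of "\<lambda>m. U m s", OF incr[OF s]], of K]
      unfolding convergent_def by metis
    then show ?thesis unfolding u_def by (rule convergent_LIMSEQ_iff[THEN iffD1])
  qed
  have V: "r \<ge> 0 \<Longrightarrow> (\<lambda>m. T2 (U m) r) \<longlonglongrightarrow> T2 u r" for r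
    by (rule radial_map_limit(1)[OF phi2 N1 a2 f2 Uc Un bdd lim])
  have T2u: "r \<ge> 0 \<Longrightarrow> T2 (U m) r \<le> T2 u r" for m r
  proof (rule incseq_le[OF incseq_SucI V])
    show "T2 (U m) r \<le> T2 (U (Suc m)) r" for m
      by (rule radial_map_mono[OF phi2 N1 a2 f2 Uc Uc Un incr])
  qed
  have T2uc: "continuous_on {0..} (T2 u)"
    by (rule radial_map_limit(2)[OF phi2 N1 a2 f2 Uc Un bdd lim])
  have Vbdd: "\<exists>K. \<forall>m. \<forall>s\<in>{0..r}. T2 (U m) s \<le> K" if "r \<ge> 0" for r
  proof -
    \<comment> \<open>The iterates increase to \<open>T2 u\<close>, which is continuous and hence bounded on \<open>[0,r]\<close>.\<close>
    have "compact (T2 u ` {0..r})"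
      by (intro compact_continuous_image continuous_on_subset[OF T2uc]) auto
    then obtain K where "\<forall>x\<in>T2 u ` {0..r}. x \<le> K"
      using bounded_imp_bdd_above[OF compact_imp_bounded] unfolding bdd_above_def by blast
    then have "T2 (U m) s \<le> K" if "s \<in> {0..r}" for m s
      using T2u[of s m] that by force
    then show ?thesis by blast
  qed
  have fp: "u r = T1 (T2 u) r" if r: "r \<ge> 0" for r
  proof (rule LIMSEQ_unique)
    show "(\<lambda>m. U (Suc m) r) \<longlonglongrightarrow> u r" using lim[OF r] by (rule LIMSEQ_Suc)
    show "(\<lambda>m. U (Suc m) r) \<longlonglongrightarrow> T1 (T2 u) r"
      unfolding US by (rule radial_map_limit(1)[OF phi1 N1 a1 f1 Vc Vn Vbdd V r])
  qed
  have "continuous_on {0..} (T1 (T2 u))"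
    by (rule radial_map_limit(2)[OF phi1 N1 a1 f1 Vc Vn Vbdd V])
  then have "continuous_on {0..} u"
    by (rule continuous_on_eq) (use fp in auto)
  moreover have "u s \<ge> \<alpha>" if "s \<ge> 0" for s
    by (rule LIMSEQ_le_const[OF lim[OF that]]) (simp add: Ua that)
  ultimately show ?thesis using fp that by blast
qed

end

theorem theorem2p2:
  fixes N :: nat
    and \<alpha> \<beta> kl1 ku1 kl2 ku2 M1 M2 c1 c2 :: real
    and \<phi>1 \<phi>2 \<theta>l1 \<theta>u1 \<theta>l2 \<theta>u2 \<psi>l1 \<psi>u1 \<psi>l2 \<psi>u2 :: "real \<Rightarrow> real"
    and a1 a2 f1 f2 g1 g2 \<xi>1 \<xi>2 :: "real \<Rightarrow> real"
  assumes "N = CARD('n::finite)" and "N \<ge> 3"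
    and "\<alpha> > 0" and "\<beta> > 0"
    and "phi_structure \<phi>1 kl1 ku1 \<theta>l1 \<theta>u1 \<psi>l1 \<psi>u1"
    and "phi_structure \<phi>2 kl2 ku2 \<theta>l2 \<theta>u2 \<psi>l2 \<psi>u2"
    and "cont_nonneg a1" and "cont_nonneg a2"
    and "cont_incr_nonneg f1" and "cont_incr_nonneg f2"
    and "f1 0 * f2 0 \<ge> 0"
    and "\<And>s1 s2. s1 > 0 \<Longrightarrow> s2 > 0 \<Longrightarrow> f1 s1 * f2 s2 > 0"
    and "M1 \<ge> max 1 (\<beta> / \<theta>u2 (f2 \<alpha>))" and "M2 \<ge> max 1 (\<alpha> / \<theta>u1 (f1 \<beta>))"
    and "c1 > 0" and "c2 > 0"
    and "cont_incr_nonneg g1" and "cont_incr_nonneg g2"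
    and "cont_nonneg \<xi>1" and "cont_nonneg \<xi>2"
    and "\<And>w t. w \<ge> 1 \<Longrightarrow> t \<ge> M1 * \<theta>u2 (f2 \<alpha>) \<Longrightarrow> f1 (t * w) \<le> c1 * g1 t * \<xi>1 w"
    and "\<And>w t. w \<ge> 1 \<Longrightarrow> t \<ge> M2 * \<theta>u1 (f1 \<beta>) \<Longrightarrow> f2 (t * w) \<le> c2 * g2 t * \<xi>2 w"
    and "filterlim (H_fun \<alpha> \<theta>u1 g1 M1 \<theta>u2 f2) at_top at_top"
    and "filterlim (H_fun \<beta> \<theta>u2 g2 M2 \<theta>u1 f1) at_top at_top"
  shows "\<exists>u v. C1_on {0..} u \<and> C1_on {0..} v \<and> u 0 = \<alpha> \<and> v 0 = \<beta> \<and>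
      positive_entire_solution \<phi>1 \<phi>2 a1 a2 f1 f2
        (\<lambda>x::real^'n. u (norm x)) (\<lambda>x::real^'n. v (norm x)) \<and>
      ((\<exists>L. (P_bar N c1 \<psi>u1 \<xi>1 a1 (A_bar N ku2 \<psi>u2 a2) \<longlongrightarrow> L) at_top) \<and>
       (\<exists>L. (P_bar N c2 \<psi>u2 \<xi>2 a2 (A_bar N ku1 \<psi>u1 a1) \<longlongrightarrow> L) at_top) \<longrightarrow>
       (\<exists>L. (u \<longlongrightarrow> L) at_top) \<and> (\<exists>L. (v \<longlongrightarrow> L) at_top))"
proof -
  note N = assms(1) and phi1 = assms(5) and phi2 = assms(6) and a1 = assms(7) and a2 = assms(8)
    and f1 = assms(9) and f2 = assms(10)
  have N1: "N \<ge> 1" using \<open>N \<ge> 3\<close> by simp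
  have f_pos: "f1 s > 0" "f2 s > 0" if "s > 0" for s
    using assms(12)[OF that that] cont_incr_nonneg_nonneg[OF f1, of s]
      cont_incr_nonneg_nonneg[OF f2, of s] that
    by (auto simp: zero_less_mult_iff)
  have M1: "M1 \<ge> 1" "\<beta> \<le> M1 * \<theta>u2 (f2 \<alpha>)"
    using assms(13) theta_upper_pos[OF phi2 f_pos(2)[OF \<open>\<alpha> > 0\<close>]] by (auto simp: divide_simps)
  have M2: "M2 \<ge> 1" "\<alpha> \<le> M2 * \<theta>u1 (f1 \<beta>)"
    using assms(14) theta_upper_pos[OF phi1 f_pos(1)[OF \<open>\<beta> > 0\<close>]] by (auto simp: divide_simps)
  interpret uv: keller_osserman N \<alpha> \<beta> kl1 ku1 kl2 ku2 M1 c1 \<phi>1 \<phi>2 \<theta>l1 \<theta>u1 \<theta>l2 \<theta>u2 \<psi>l1 \<psi>u1 \<psi>l2 \<psi>u2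
    a1 a2 f1 f2 g1 \<xi>1
    by (unfold_locales; fact assms N1 f_pos M1)
  interpret vu: keller_osserman N \<beta> \<alpha> kl2 ku2 kl1 ku1 M2 c2 \<phi>2 \<phi>1 \<theta>l2 \<theta>u2 \<theta>l1 \<theta>u1 \<psi>l2 \<psi>u2 \<psi>l1 \<psi>u1
    a2 a1 f2 f1 g2 \<xi>2
    by (unfold_locales; fact assms N1 f_pos M2)
  obtain w where w: "continuous_on {0..} w" "\<And>s. s \<ge> 0 \<Longrightarrow> w s \<ge> \<alpha>"
    and fp: "\<And>s. s \<ge> 0 \<Longrightarrow> w s = uv.T1 (uv.T2 w) s"
    using uv.fixed_point_exists by blast
  have w0: "w s \<ge> 0" if "s \<ge> 0" for s using w(2)[OF that] \<open>\<alpha> > 0\<close> by simp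
  define v where "v = uv.T2 w"
  define u where "u = uv.T1 v"
  \<comment> \<open>\<open>w\<close> satisfies the fixed-point equation on \<open>[0,\<infinity>)\<close> only, whereas \<open>u\<close> is an image of \<open>T1\<close> on the
    whole line, as \<open>radial_op_phi_laplacian\<close> requires. Norms do not see the difference.\<close>
  have wu: "w s = u s" if "s \<ge> 0" for s using fp[OF that] by (simp add: u_def v_def)
  have v: "continuous_on {0..} v" "\<And>s. s \<ge> 0 \<Longrightarrow> v s \<ge> \<beta>" "\<And>s. s \<ge> 0 \<Longrightarrow> v s \<ge> 0"
    unfolding v_def
    by (rule radial_map_continuous[OF phi2 N1 a2 f2 w(1) w0] radial_map_ge[OF phi2 N1 a2 f2 w(1) w0]
        radial_map_nonneg[OF phi2 N1 a2 f2 \<open>\<beta> > 0\<close> w(1) w0]; assumption)+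
  have u_ge: "u s \<ge> \<alpha>" if "s \<ge> 0" for s using w(2)[OF that] wu[OF that] by simp
  have vu_fp: "v s = vu.T1 (vu.T2 v) s" if "s \<ge> 0" for s
    unfolding v_def[THEN fun_cong] u_def[symmetric] by (rule radial_map_cong) (rule wu)
  have src1: "continuous_on {0..} (\<lambda>s. a1 s * f1 (v s))" "\<And>s. s \<ge> 0 \<Longrightarrow> a1 s * f1 (v s) \<ge> 0"
    by (rule source_continuous[OF a1 f1 v(1,3)], assumption)
      (rule source_nonneg[OF a1 f1 v(3)], assumption+)
  have src2: "continuous_on {0..} (\<lambda>s. a2 s * f2 (w s))" "\<And>s. s \<ge> 0 \<Longrightarrow> a2 s * f2 (w s) \<ge> 0"
    by (rule source_continuous[OF a2 f2 w(1) w0], assumption)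
      (rule source_nonneg[OF a2 f2 w0], assumption+)
  have dim: "N = DIM(real^'n)" using N by simp
  have "C1_on {0..} u" "C1_on {0..} v"
    unfolding u_def v_def radial_map_def
    by (rule radial_op_C1[OF phi1 N1 src1(1)[unfolded v_def radial_map_def]] radial_op_C1[OF phi2 N1 src2(1)])+
  moreover have "u 0 = \<alpha>" "v 0 = \<beta>"
    by (simp_all add: u_def v_def radial_map_def radial_op_0)
  moreover have "positive_entire_solution \<phi>1 \<phi>2 a1 a2 f1 f2
      (\<lambda>x::real^'n. u (norm x)) (\<lambda>x::real^'n. v (norm x))"
    unfolding positive_entire_solution_def
  proof (intro allI conjI)
    fix x :: "real^'n"
    show "u (norm x) > 0" using u_ge[of "norm x"] \<open>\<alpha> > 0\<close> by simp
    show "v (norm x) > 0" using v(2)[of "norm x"] \<open>\<beta> > 0\<close> by simp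
    show "has_phi_laplacian \<phi>1 (\<lambda>x. u (norm x)) (a1 (norm x) * f1 (v (norm x))) x"
      unfolding u_def radial_map_def by (rule radial_op_phi_laplacian[OF phi1 dim src1])
    have "has_phi_laplacian \<phi>2 (\<lambda>x. v (norm x)) (a2 (norm x) * f2 (w (norm x))) x"
      unfolding v_def radial_map_def by (rule radial_op_phi_laplacian[OF phi2 dim src2])
    then show "has_phi_laplacian \<phi>2 (\<lambda>x. v (norm x)) (a2 (norm x) * f2 (u (norm x))) x"
      by (simp add: wu)
  qed
  moreover have "\<exists>l. (u \<longlongrightarrow> l) at_top" if P: "(uv.P \<longlongrightarrow> L) at_top" for L
  proof -
    obtain l where "(w \<longlongrightarrow> l) at_top"
      using uv.fixed_point_limit[OF w(1) w0 fp P] by blast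
    moreover have "eventually (\<lambda>s. w s = u s) at_top"
      using eventually_ge_at_top[of 0] by eventually_elim (rule wu)
    ultimately show ?thesis using Lim_transform_eventually by blast
  qed
  moreover have "\<exists>l. (v \<longlongrightarrow> l) at_top" if "(vu.P \<longlongrightarrow> L) at_top" for L
    by (rule vu.fixed_point_limit[OF v(1,3) vu_fp that])
  ultimately show ?thesis by blast
qed

end
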